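(* Let $d\ge 1$, let $L\subset\mathbb{R}^d$ be a lattice with fundamental domain $\Omega$ and dual lattice $L^{\perp}$. Let $0<\alpha<1$ and $f\in L^2(\Omega)$. Then $f\in\mathrm{Lip}_{\Omega}(\alpha;2)$ if and only if $$\sum_{\kappa\in L^{\perp},\ |\kappa|>N}|\widehat f(\kappa)|^2=O(N^{-2\alpha})\quad\text{as }N\to\infty .$$
   Context: A lattice is $L=A\mathbb{Z}^d$ with $A$ an invertible real $d\times d$ matrix; its dual lattice is $L^{\perp}:=(A^{T})^{-1}\mathbb{Z}^d$. A fundamental domain of $L$ is a measurable set $\Omega\subseteq\mathbb{R}^d$ such that $\Omega+L=\mathbb{R}^d$ as a direct sum (every $x\in\mathbb{R}^d$ is uniquely $\omega+\ell$ with $\omega\in\Omega$, $\ell\in L$). $L^p(\Omega)$ is taken with respect to the normalised measure $\mathrm{d}x/|\Omega|$; functions on $\Omega$ are extended $L$-periodically to $\mathbb{R}^d$, which gives meaning to $f(\cdot+h)$. The Fourier transform is $\widehat f(\kappa)=\frac{1}{|\Omega|}\int_{\Omega}f(x)e^{-2\pi i\kappa\cdot x}\,\mathrm{d}x$ for $\kappa\in L^{\perp}$. For $0<\alpha\le1$, $1<p\le\infty$, the additive Hölder-Lipschitz space is $$\mathrm{Lip}_{\Omega}(\alpha;p):=\{f\in L^p(\Omega): \|f(\cdot+h)-f(\cdot)\|_{L^p(\Omega)}=O(|h|^{\alpha})\text{ as }h\to0\}.$$ Here $|\cdot|$ is the Euclidean norm, $N$ ranges over natural numbers, and $F=O(G)$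 means that there is a constant $C>0$ such that $F\le CG$ in a neighbourhood of the limit point (for $h$ near $0$, respectively for all sufficiently large $N$). *)

theory Defs
  imports "HOL-Probability.Probability"
begin

definition lattice_of :: "real^'n^'n \<Rightarrow> (real^'n) set" where
  "lattice_of A = (\<lambda>z. A *v z) ` {z. \<forall>i. z $ i \<in> \<int>}"

definition dual_lattice :: "real^'n^'n \<Rightarrow> (real^'n) set" where
  "dual_lattice A = lattice_of (matrix_inv (transpose A))"

definition fundamental_domain :: "(real^'n) set \<Rightarrow> (real^'n) set \<Rightarrow> bool" where
  "fundamental_domain L \<Omega> \<longleftrightarrow>
     \<Omega> \<in> sets lebesgue \<and> bij_betw (\<lambda>(\<omega>, l). \<omega> + l) (\<Omega> \<times> L) UNIV"

text \<open>The underlying space of the normalised measure is \<open>\<Omega>\<close> itself, so that measurability and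
  integrability of a function \<open>f\<close> only involve the values of \<open>f\<close> on \<open>\<Omega>\<close>.\<close>

definition normalised_measure :: "(real^'n) set \<Rightarrow> (real^'n) measure" where
  "normalised_measure \<Omega> = uniform_measure (lebesgue_on \<Omega>) \<Omega>"

definition Lp_space :: "'a measure \<Rightarrow> ennreal \<Rightarrow> ('a \<Rightarrow> complex) set" where
  "Lp_space M p = {f \<in> borel_measurable M.
     if p = \<infinity> then esssup M (\<lambda>x. ennreal (cmod (f x))) < \<infinity>
     else integrable M (\<lambda>x. cmod (f x) powr enn2real p)}"

text \<open>The value is meaningful for members of \<open>Lp_space M p\<close> only; elements of \<open>L\<^sup>p\<close> are represented
  by functions rather than by classes modulo null sets.\<close>

definition Lp_norm :: "'a measure \<Rightarrow> ennreal \<Rightarrow> ('a \<Rightarrow> complex) \<Rightarrow> real" where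
  "Lp_norm M p f =
     (if p = \<infinity> then enn2real (esssup M (\<lambda>x. ennreal (cmod (f x))))
      else (\<integral>x. cmod (f x) powr enn2real p \<partial>M) powr (1 / enn2real p))"

text \<open>A function on \<open>\<Omega>\<close> is represented by a total function whose values outside \<open>\<Omega>\<close> are ignored;
  the \<open>L\<close>-periodic extension reads it off at the representative in \<open>\<Omega>\<close>.\<close>

definition periodic_ext :: "(real^'n) set \<Rightarrow> (real^'n) set \<Rightarrow> (real^'n \<Rightarrow> complex) \<Rightarrow> real^'n \<Rightarrow> complex" where
  "periodic_ext L \<Omega> f x = f (THE \<omega>. \<omega> \<in> \<Omega> \<and> x - \<omega> \<in> L)"

definition fourier_coeff :: "(real^'n) set \<Rightarrow> (real^'n \<Rightarrow> complex) \<Rightarrow> real^'n \<Rightarrow> complex" where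
  "fourier_coeff \<Omega> f \<kappa> =
     complex_of_real (1 / measure lebesgue \<Omega>) *
     (\<integral>x. f x * exp (- 2 * complex_of_real pi * \<i> * complex_of_real (\<kappa> \<bullet> x)) \<partial>(lebesgue_on \<Omega>))"

text \<open>If \<open>f\<close> is in \<open>L\<^sup>p(\<Omega>)\<close>, so are all differences \<open>f(\<cdot> + h) - f\<close>, hence \<open>Lp_norm\<close> is applied
  to members of \<open>L\<^sup>p(\<Omega>)\<close> only.\<close>

definition Lip :: "(real^'n) set \<Rightarrow> (real^'n) set \<Rightarrow> real \<Rightarrow> ennreal \<Rightarrow> (real^'n \<Rightarrow> complex) set" where
  "Lip L \<Omega> \<alpha> p = {f \<in> Lp_space (normalised_measure \<Omega>) p.
     (\<lambda>h. Lp_norm (normalised_measure \<Omega>) p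
            (\<lambda>x. periodic_ext L \<Omega> f (x + h) - periodic_ext L \<Omega> f x))
     \<in> O[at 0](\<lambda>h. norm h powr \<alpha>)}"

end

theory Submission
  imports Defs
begin

text \<open>The difference \<open>f(\<cdot> + h) - f\<close> has Fourier coefficients \<open>(e(\<kappa> \<cdot> h) - 1) c(\<kappa>)\<close>, where \<open>c(\<kappa>)\<close>
  are those of \<open>f\<close> and \<open>e(t) = exp(2\<pi>\<i>t)\<close>, so by Parseval the squared \<open>L\<^sup>2\<close> modulus of continuity at \<open>h\<close> is
  the sum of \<open>|e(\<kappa> \<cdot> h) - 1|\<^sup>2 |c(\<kappa>)|\<^sup>2\<close>. If \<open>f\<close> is Lipschitz of order \<open>\<alpha>\<close>, Bessel's inequality for the
  coordinate shifts \<open>h = e\<^sub>j/(4N)\<close> bounds the dyadic block \<open>N < |\<kappa>| \<le> 2N\<close>, and the blocks add up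
  geometrically. Conversely, cut the frequencies at \<open>1/|h|\<close>: the high ones are bounded by a tail, and for the
  low ones \<open>|e(\<kappa> \<cdot> h) - 1| \<le> 2\<pi>|\<kappa>||h|\<close> and dyadic summation (using \<open>\<alpha> < 1\<close>) give the same order.
  Completeness of the characters in \<open>L\<^sup>2(\<Omega>)\<close> comes from the Stone-Weierstrass theorem on compact subsets of \<open>\<Omega>\<close>.\<close>

section \<open>Dyadic summation\<close>

text \<open>A fundamental domain is merely measurable here: it may be unbounded and far from a
  parallelepiped, so even 0 < |\<Omega>| < \<infinity> has to be derived from the tiling. The torus
  is never built; translation by h becomes a self-map of \<Omega> preserving the normalised measure,
  and this invariance yields both the orthonormality of the characters and the factor in the
  coefficients of a shifted function. Parseval is split into two inequalities: Bessel serves the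
  direction from Lipschitz to tails, and only the converse needs completeness. Both are formulated
  for finite sets of frequencies with bounds independent of the set, so no Fourier series has to
  converge in the mean, and infinite sums of coefficients are reached only by comparison with finite
  ones. The range of \<alpha> makes both dyadic sums geometric: blocks of the tail shrink by 2^(-2
  \<alpha>) as \<alpha> > 0, so the first one dominates; weighted low blocks grow by 4^(1 -
  \<alpha>) as \<alpha> < 1, so the last one does.\<close>

lemma sum_tail_le_of_dyadic_blocks:
  fixes a w :: "'a \<Rightarrow> real" and N :: nat
  assumes F: "finite F" and "\<beta> > 0" and "C \<ge> 0" and "1 \<le> N0" and "N0 \<le> N"
    and blocks: "\<And>N. N0 \<le> N \<Longrightarrow> sum a {x \<in> F. real N < w x \<and> w x \<le> 2 * real N} \<le> C * real N powr - \<beta>"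
  shows "sum a {x \<in> F. real N < w x} \<le> C / (1 - 2 powr - \<beta>) * real N powr - \<beta>"
proof -
  \<comment> \<open>The sum of the geometric series C + C 2^(-\<beta>) + ..., that is, the solution
    of K = C + K 2^(-\<beta>). With it the induction reproduces its own constant when the first
    block is split off and N is doubled.\<close>
  define K where "K = C / (1 - 2 powr - \<beta>)"
  have lt1: "2 powr - \<beta> < (1::real)" using \<open>\<beta> > 0\<close> by (simp add: powr_less_one)
  have K0: "K \<ge> 0" using \<open>C \<ge> 0\<close> lt1 by (simp add: K_def)
  have "K * (1 - 2 powr - \<beta>) = C" using lt1 \<open>\<beta> > 0\<close> by (simp add: K_def)
  then have CK: "C + K * 2 powr - \<beta> = K" by (simp add: algebra_simps)
  have *: "sum a {x \<in> F. real N < w x \<and> w x \<le> 2 ^ m * real N} \<le> K * real N powr - \<beta>" if "N0 \<le> N" for m N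
    using that
  proof (induction m arbitrary: N)
    case 0
    have "{x \<in> F. real N < w x \<and> w x \<le> 2 ^ 0 * real N} = {}" by auto
    then show ?case using K0 by (metis powr_ge_zero sum.empty zero_le_mult_iff)
  next
    case (Suc m)
    have "{x \<in> F. real N < w x \<and> w x \<le> 2 ^ Suc m * real N} \<subseteq> {x \<in> F. real N < w x \<and> w x \<le> 2 * real N}
        \<union> {x \<in> F. real (2 * N) < w x \<and> w x \<le> 2 ^ m * real (2 * N)}" by auto
    moreover have "{x \<in> F. real N < w x \<and> w x \<le> 2 * real N}
        \<union> {x \<in> F. real (2 * N) < w x \<and> w x \<le> 2 ^ m * real (2 * N)} \<subseteq> {x \<in> F. real N < w x \<and> w x \<le> 2 ^ Suc m * real N}"
    proof -
      have le: "2 * real N \<le> 2 ^ Suc m * real N" by (intro mult_right_mono) auto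
      have "w x \<le> 2 ^ Suc m * real N" if "w x \<le> 2 * real N" for x using order_trans[OF that le] .
      then show ?thesis by auto
    qed
    ultimately have "{x \<in> F. real N < w x \<and> w x \<le> 2 ^ Suc m * real N} = {x \<in> F. real N < w x \<and> w x \<le> 2 * real N}
        \<union> {x \<in> F. real (2 * N) < w x \<and> w x \<le> 2 ^ m * real (2 * N)}" by blast
    then have "sum a {x \<in> F. real N < w x \<and> w x \<le> 2 ^ Suc m * real N}
        = sum a {x \<in> F. real N < w x \<and> w x \<le> 2 * real N}
          + sum a {x \<in> F. real (2 * N) < w x \<and> w x \<le> 2 ^ m * real (2 * N)}"
      using F by (simp only:) (subst sum.union_disjoint, auto)
    also have "\<dots> \<le> C * real N powr - \<beta> + K * real (2 * N) powr - \<beta>"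
      using Suc.IH[of "2 * N"] Suc.prems blocks[OF Suc.prems] by linarith
    also have "\<dots> = (C + K * 2 powr - \<beta>) * real N powr - \<beta>"
      by (simp add: powr_mult algebra_simps)
    finally show ?case by (simp only: CK)
  qed
  \<comment> \<open>Only finitely many weights occur, so for large m the cut-off at 2^m N removes
    nothing and the bound, uniform in m, covers the whole tail.\<close>
  have "\<exists>m. \<forall>x\<in>F. w x \<le> 2 ^ m * real N"
  proof -
    obtain m :: nat where m: "Max (insert 0 (w ` F)) < 2 ^ m" using real_arch_pow[of 2] by auto
    have "w x \<le> 2 ^ m * real N" if "x \<in> F" for x
    proof -
      have "w x \<le> Max (insert 0 (w ` F))" using F that by (intro Max_ge) auto
      also have "\<dots> \<le> 2 ^ m * 1" using m by simp
      also have "\<dots> \<le> 2 ^ m * real N" using assms by (intro mult_left_mono) auto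
      finally show ?thesis .
    qed
    then show ?thesis by blast
  qed
  then obtain m where "\<forall>x\<in>F. w x \<le> 2 ^ m * real N" by blast
  then have "{x \<in> F. real N < w x} = {x \<in> F. real N < w x \<and> w x \<le> 2 ^ m * real N}" by auto
  with *[OF \<open>N0 \<le> N\<close>] show ?thesis by (simp add: K_def)
qed

text \<open>On the block 2^n < w \<le> 2^(n+1) the squared weight is at most 4 * 4^n and the mass at
  most the tail C 4^(-\<alpha> n), so the block contributes at most 4 C q^n with q = 4^(1 -
  \<alpha>) > 1. The term S pays for the weights up to 1, and 4 C / (q - 1) is what makes K + 4 C
  \<le> K q, which the induction step needs.\<close>

lemma weighted_sum_le_of_dyadic_tails:
  fixes a w :: "'a \<Rightarrow> real"
  assumes F: "finite F" and a: "\<And>x. x \<in> F \<Longrightarrow> 0 \<le> a x" and w: "\<And>x. x \<in> F \<Longrightarrow> 0 \<le> w x"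
    and "\<alpha> < 1" and "C \<ge> 0" and S: "sum a F \<le> S"
    and tails: "\<And>n::nat. sum a {x \<in> F. 2 ^ n < w x} \<le> C * (4 powr - \<alpha>) ^ n"
  shows "(\<Sum>x\<in>{x \<in> F. w x \<le> 2 ^ n}. (w x)\<^sup>2 * a x) \<le> (S + 4 * C / (4 powr (1 - \<alpha>) - 1)) * (4 powr (1 - \<alpha>)) ^ n"
proof -
  define q where "q = 4 powr (1 - \<alpha>)"
  define K where "K = S + 4 * C / (q - 1)"
  have q1: "q > 1" using \<open>\<alpha> < 1\<close> by (simp add: q_def)
  have "0 \<le> sum a F" using a by (rule sum_nonneg)
  then have "S \<ge> 0" using S by linarith
  then have K0: "K \<ge> 0" using q1 \<open>C \<ge> 0\<close> by (simp add: K_def)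
  have "K * (q - 1) = S * (q - 1) + 4 * C" using q1 by (simp add: K_def distrib_right)
  moreover have "S * (q - 1) \<ge> 0" using \<open>S \<ge> 0\<close> q1 by simp
  ultimately have KC: "4 * C + K \<le> K * q" by (simp add: algebra_simps)
  have q4: "4 * 4 powr - \<alpha> = q" by (simp add: q_def powr_diff powr_minus field_simps)
  have "(\<Sum>x\<in>{x \<in> F. w x \<le> 2 ^ n}. (w x)\<^sup>2 * a x) \<le> K * q ^ n"
  proof (induction n)
    case 0
    have "(\<Sum>x\<in>{x \<in> F. w x \<le> 2 ^ 0}. (w x)\<^sup>2 * a x) \<le> (\<Sum>x\<in>{x \<in> F. w x \<le> 2 ^ 0}. a x)"
      using a w by (intro sum_mono) (auto intro!: mult_left_le_one_le power_le_one)
    also have "\<dots> \<le> sum a F" using F a by (intro sum_mono2) auto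
    also have "\<dots> \<le> K" using S q1 \<open>C \<ge> 0\<close> by (simp add: K_def add_increasing2)
    finally show ?case by simp
  next
    case (Suc n)
    have eq: "{x \<in> F. w x \<le> 2 ^ Suc n} = {x \<in> F. w x \<le> 2 ^ n} \<union> {x \<in> F. 2 ^ n < w x \<and> w x \<le> 2 ^ Suc n}"
    proof -
      have "w x \<le> 2 ^ Suc n" if "w x \<le> 2 ^ n" for x
        by (rule order_trans[OF that]) simp
      then show ?thesis by auto
    qed
    have "(\<Sum>x\<in>{x \<in> F. w x \<le> 2 ^ Suc n}. (w x)\<^sup>2 * a x) = (\<Sum>x\<in>{x \<in> F. w x \<le> 2 ^ n}. (w x)\<^sup>2 * a x)
        + (\<Sum>x\<in>{x \<in> F. 2 ^ n < w x \<and> w x \<le> 2 ^ Suc n}. (w x)\<^sup>2 * a x)"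
      unfolding eq using F by (intro sum.union_disjoint) auto
    also have "(\<Sum>x\<in>{x \<in> F. 2 ^ n < w x \<and> w x \<le> 2 ^ Suc n}. (w x)\<^sup>2 * a x)
        \<le> (\<Sum>x\<in>{x \<in> F. 2 ^ n < w x \<and> w x \<le> 2 ^ Suc n}. (2 ^ Suc n)\<^sup>2 * a x)"
      using a w by (intro sum_mono mult_right_mono power_mono) auto
    also have "\<dots> = (2 ^ Suc n)\<^sup>2 * (\<Sum>x\<in>{x \<in> F. 2 ^ n < w x \<and> w x \<le> 2 ^ Suc n}. a x)"
      by (simp add: sum_distrib_left)
    also have "\<dots> \<le> (2 ^ Suc n)\<^sup>2 * (C * (4 powr - \<alpha>) ^ n)"
      using F a by (intro mult_left_mono order_trans[OF _ tails] sum_mono2) auto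
    also have "\<dots> = 4 * C * q ^ n"
    proof -
      have "((2::real) ^ n)\<^sup>2 = 4 ^ n" by (simp add: power2_eq_square flip: power_mult_distrib)
      then have "((2::real) ^ Suc n)\<^sup>2 = 4 * 4 ^ n" by (simp add: power_mult_distrib)
      then show ?thesis unfolding q4[symmetric] power_mult_distrib by simp
    qed
    finally have "(\<Sum>x\<in>{x \<in> F. w x \<le> 2 ^ Suc n}. (w x)\<^sup>2 * a x) \<le> K * q ^ n + 4 * C * q ^ n"
      using Suc.IH by linarith
    also have "\<dots> = (4 * C + K) * q ^ n" by (simp add: algebra_simps)
    also have "\<dots> \<le> K * q * q ^ n" using KC q1 by (intro mult_right_mono) auto
    finally show ?case by (simp add: mult.assoc)
  qed
  then show ?thesis by (simp add: K_def q_def)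
qed

section \<open>Orthonormal systems in a probability space\<close>

lemma cmod_add_sq_le: "(cmod (x + y))\<^sup>2 \<le> 2 * (cmod x)\<^sup>2 + 2 * (cmod y)\<^sup>2"
proof -
  have "(cmod (x + y))\<^sup>2 \<le> (cmod x + cmod y)\<^sup>2" by (intro power_mono norm_triangle_ineq) auto
  also have "\<dots> \<le> 2 * (cmod x)\<^sup>2 + 2 * (cmod y)\<^sup>2"
    using sum_squares_bound[of "cmod x" "cmod y"] by (simp add: power2_sum)
  finally show ?thesis .
qed

text \<open>The natural power 2 replaces the real power of \<open>Lp_space\<close>;
  \<open>L2_iff_Lp_space\<close> reconciles the two. Functions need not be identified modulo null
  sets, since only integrals of them are compared.\<close>

definition (in prob_space) L2 :: "('a \<Rightarrow> complex) \<Rightarrow> bool" where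
  "L2 f \<longleftrightarrow> f \<in> borel_measurable M \<and> integrable M (\<lambda>x. (cmod (f x))\<^sup>2)"

context prob_space begin

lemma L2_add:
  assumes f: "L2 f" and g: "L2 g"
  shows "L2 (\<lambda>x. f x + g x)"
proof -
  have [measurable]: "f \<in> borel_measurable M" "g \<in> borel_measurable M" using f g by (auto simp: L2_def)
  have "integrable M (\<lambda>x. (cmod (f x + g x))\<^sup>2)"
  proof (rule Bochner_Integration.integrable_bound)
    show "integrable M (\<lambda>x. 2 * (cmod (f x))\<^sup>2 + 2 * (cmod (g x))\<^sup>2)"
      using f g by (auto simp: L2_def)
  qed (use cmod_add_sq_le in \<open>auto simp del: power_mult_distrib\<close>)
  then show ?thesis by (simp add: L2_def)
qed

lemma L2_cmult: "L2 f \<Longrightarrow> L2 (\<lambda>x. c * f x)"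
  by (auto simp: L2_def norm_mult power_mult_distrib)

lemma L2_diff: "L2 f \<Longrightarrow> L2 g \<Longrightarrow> L2 (\<lambda>x. f x - g x)"
  using L2_add[of f "\<lambda>x. - 1 * g x"] L2_cmult[of g "- 1"] by simp

lemma L2_bounded:
  assumes [measurable]: "f \<in> borel_measurable M" and "\<And>x. x \<in> space M \<Longrightarrow> cmod (f x) \<le> B"
  shows "L2 f"
proof -
  have "integrable M (\<lambda>x. (cmod (f x))\<^sup>2)"
    using assms by (intro integrable_const_bound[where B = "B\<^sup>2"]) (auto intro!: power_mono)
  then show ?thesis by (simp add: L2_def)
qed

lemma L2_mult_cnj_integrable:
  assumes f: "L2 f" and g: "L2 g"
  shows "integrable M (\<lambda>x. f x * cnj (g x))"
proof -
  have [measurable]: "f \<in> borel_measurable M" "g \<in> borel_measurable M" using f g by (auto simp: L2_def)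
  have [measurable]: "cnj \<in> borel_measurable borel" by (intro borel_measurable_continuous_onI continuous_intros)
  show ?thesis
  proof (rule Bochner_Integration.integrable_bound)
    show "integrable M (\<lambda>x. (cmod (f x))\<^sup>2 + (cmod (g x))\<^sup>2)" using f g by (auto simp: L2_def)
    have "cmod x * cmod y \<le> (cmod x)\<^sup>2 + (cmod y)\<^sup>2" for x y
    proof -
      have "0 \<le> cmod x * cmod y" by simp
      with sum_squares_bound[of "cmod x" "cmod y"] show ?thesis unfolding mult.assoc by linarith
    qed
    then show "AE x in M. norm (f x * cnj (g x)) \<le> norm ((cmod (f x))\<^sup>2 + (cmod (g x))\<^sup>2)"
      by (auto simp: norm_mult)
  qed simp
qed

end

locale orthonormal_system = prob_space M for M :: "'a measure" +
  fixes e :: "'i \<Rightarrow> 'a \<Rightarrow> complex" and D :: "'i set"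
  assumes L2_e: "k \<in> D \<Longrightarrow> L2 (e k)"
    and orthonormal: "k \<in> D \<Longrightarrow> l \<in> D \<Longrightarrow> (\<integral>x. e k x * cnj (e l x) \<partial>M) = (if k = l then 1 else 0)"
begin

definition coeff :: "('a \<Rightarrow> complex) \<Rightarrow> 'i \<Rightarrow> complex" where
  "coeff f k = (\<integral>x. f x * cnj (e k x) \<partial>M)"

lemma coeff_diff_cmult:
  assumes "L2 f" "k \<in> D" "l \<in> D"
  shows "coeff (\<lambda>x. f x - c * e k x) l = coeff f l - (if k = l then c else 0)"
proof -
  have "coeff (\<lambda>x. f x - c * e k x) l = (\<integral>x. f x * cnj (e l x) - c * (e k x * cnj (e l x)) \<partial>M)"
    by (simp add: coeff_def algebra_simps)
  also have "\<dots> = coeff f l - c * (\<integral>x. e k x * cnj (e l x) \<partial>M)"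
    unfolding coeff_def using assms L2_e
    by (subst Bochner_Integration.integral_diff) (auto intro!: L2_mult_cnj_integrable)
  finally show ?thesis using orthonormal assms by simp
qed

lemma norm_sq_diff_cmult:
  assumes f: "L2 f" and k: "k \<in> D"
  shows "(\<integral>x. (cmod (f x - c * e k x))\<^sup>2 \<partial>M) = (\<integral>x. (cmod (f x))\<^sup>2 \<partial>M) - (cmod (coeff f k))\<^sup>2 + (cmod (c - coeff f k))\<^sup>2"
proof -
  have i: "integrable M (\<lambda>x. f x * cnj (e k x))" using f k L2_e by (intro L2_mult_cnj_integrable)
  have i2: "integrable M (\<lambda>x. (cmod (f x))\<^sup>2)" "integrable M (\<lambda>x. (cmod (e k x))\<^sup>2)"
    using f k L2_e by (auto simp: L2_def)
  have "complex_of_real (\<integral>x. (cmod (e k x))\<^sup>2 \<partial>M) = (\<integral>x. e k x * cnj (e k x) \<partial>M)"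
    by (simp only: complex_norm_square flip: integral_complex_of_real)
  then have 1: "(\<integral>x. (cmod (e k x))\<^sup>2 \<partial>M) = 1" using orthonormal[OF k k] by simp
  have expand: "(cmod (x - y))\<^sup>2 = (cmod x)\<^sup>2 - 2 * Re (x * cnj y) + (cmod y)\<^sup>2" for x y
    unfolding cmod_power2 by (simp add: power2_eq_square algebra_simps)
  define z where "z x = cnj c * (f x * cnj (e k x))" for x
  have z: "integrable M z" "(\<integral>x. z x \<partial>M) = cnj c * coeff f k"
    using i by (simp_all add: z_def[abs_def] coeff_def)
  have pt: "(cmod (f x - c * e k x))\<^sup>2 = (cmod (f x))\<^sup>2 - 2 * Re (z x) + (cmod c)\<^sup>2 * (cmod (e k x))\<^sup>2" for x
    by (simp add: z_def expand norm_mult power_mult_distrib algebra_simps)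
  have "(\<integral>x. (cmod (f x - c * e k x))\<^sup>2 \<partial>M) = (\<integral>x. (cmod (f x))\<^sup>2 \<partial>M) - 2 * Re (cnj c * coeff f k) + (cmod c)\<^sup>2"
    unfolding pt using z i2 1 integral_Re[OF z(1)] by simp
  also have "\<dots> = (\<integral>x. (cmod (f x))\<^sup>2 \<partial>M) - (cmod (coeff f k))\<^sup>2 + (cmod (c - coeff f k))\<^sup>2"
    by (simp add: expand algebra_simps)
  finally show ?thesis .
qed

text \<open>Expanding and completing the square handles one mode; subtracting a mode leaves all
  other coefficients unchanged by orthogonality, so the modes can be stripped off one by one. The
  choice c = \<open>coeff f\<close> gives Bessel, and dropping the last sum for general c gives the
  reverse bound.\<close>

lemma norm_sq_diff_sum:
  assumes "finite S" "S \<subseteq> D" "L2 f"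
  shows "(\<integral>x. (cmod (f x - (\<Sum>k\<in>S. c k * e k x)))\<^sup>2 \<partial>M)
    = (\<integral>x. (cmod (f x))\<^sup>2 \<partial>M) - (\<Sum>k\<in>S. (cmod (coeff f k))\<^sup>2) + (\<Sum>k\<in>S. (cmod (c k - coeff f k))\<^sup>2)"
  using assms
proof (induction S arbitrary: f rule: finite_induct)
  case empty
  then show ?case by simp
next
  case (insert k S)
  define g where "g = (\<lambda>x. f x - c k * e k x)"
  have g: "L2 g" using insert.prems L2_e by (auto simp: g_def intro!: L2_diff L2_cmult)
  have cg: "coeff g l = coeff f l" if "l \<in> S" for l
    using that insert.prems insert.hyps by (subst g_def, subst coeff_diff_cmult) auto
  have "(\<integral>x. (cmod (f x - (\<Sum>k\<in>insert k S. c k * e k x)))\<^sup>2 \<partial>M) = (\<integral>x. (cmod (g x - (\<Sum>k\<in>S. c k * e k x)))\<^sup>2 \<partial>M)"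
    using insert.hyps by (simp add: g_def algebra_simps)
  also have "\<dots> = (\<integral>x. (cmod (g x))\<^sup>2 \<partial>M) - (\<Sum>k\<in>S. (cmod (coeff f k))\<^sup>2) + (\<Sum>k\<in>S. (cmod (c k - coeff f k))\<^sup>2)"
    using insert.IH[OF _ g] insert.prems cg by simp
  finally show ?case
    using insert.prems insert.hyps norm_sq_diff_cmult[of f k "c k"] by (simp add: g_def)
qed

lemma bessel:
  assumes "finite S" "S \<subseteq> D" "L2 f"
  shows "(\<Sum>k\<in>S. (cmod (coeff f k))\<^sup>2) \<le> (\<integral>x. (cmod (f x))\<^sup>2 \<partial>M)"
  using norm_sq_diff_sum[OF assms, of "coeff f"]
    Bochner_Integration.integral_nonneg[of M "\<lambda>x. (cmod (f x - (\<Sum>k\<in>S. coeff f k * e k x)))\<^sup>2"] by simp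

text \<open>The half of Parseval that needs density. Whatever coefficients the approximating sum
  carries, the squared norm is at most the squared distance plus the sum of
  |\<open>coeff f k\<close>|^2 over the same finite set.\<close>

lemma norm_sq_le_of_partial_sums:
  assumes f: "L2 f"
    and dense: "\<And>\<epsilon>. \<epsilon> > 0 \<Longrightarrow> \<exists>S c. finite S \<and> S \<subseteq> D \<and> (\<integral>x. (cmod (f x - (\<Sum>k\<in>S. c k * e k x)))\<^sup>2 \<partial>M) < \<epsilon>"
    and B: "\<And>S. finite S \<Longrightarrow> S \<subseteq> D \<Longrightarrow> (\<Sum>k\<in>S. (cmod (coeff f k))\<^sup>2) \<le> B"
  shows "(\<integral>x. (cmod (f x))\<^sup>2 \<partial>M) \<le> B"
proof (rule field_le_epsilon)
  fix \<epsilon> :: real assume "\<epsilon> > 0"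
  then obtain S c where S: "finite S" "S \<subseteq> D"
      "(\<integral>x. (cmod (f x - (\<Sum>k\<in>S. c k * e k x)))\<^sup>2 \<partial>M) < \<epsilon>"
    using dense by blast
  have "(\<Sum>k\<in>S. (cmod (c k - coeff f k))\<^sup>2) \<ge> 0" by (intro sum_nonneg) auto
  with S norm_sq_diff_sum[OF S(1,2) f, of c] B[OF S(1,2)]
  show "(\<integral>x. (cmod (f x))\<^sup>2 \<partial>M) \<le> B + \<epsilon>" by linarith
qed

end

section \<open>Lattices and fundamental domains\<close>

lemma lattice_of_zero: "0 \<in> lattice_of A"
  unfolding lattice_of_def by (intro image_eqI[of _ _ 0]) auto

lemma lattice_of_add:
  assumes "x \<in> lattice_of A" "y \<in> lattice_of A" shows "x + y \<in> lattice_of A"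
proof -
  obtain z w where "x = A *v z" "\<forall>i. z $ i \<in> \<int>" "y = A *v w" "\<forall>i. w $ i \<in> \<int>"
    using assms by (auto simp: lattice_of_def)
  then have "x + y = A *v (z + w)" "\<forall>i. (z + w) $ i \<in> \<int>" by (auto simp: matrix_vector_right_distrib)
  then show ?thesis unfolding lattice_of_def by blast
qed

lemma lattice_of_uminus:
  assumes "x \<in> lattice_of A" shows "- x \<in> lattice_of A"
proof -
  obtain z where "x = A *v z" "\<forall>i. z $ i \<in> \<int>" using assms by (auto simp: lattice_of_def)
  then have "- x = A *v (- z)" "\<forall>i. (- z) $ i \<in> \<int>"
    by (auto simp: matrix_vector_mult_def sum_negf vec_eq_iff)
  then show ?thesis unfolding lattice_of_def by blast
qed

lemma lattice_of_diff: "x \<in> lattice_of A \<Longrightarrow> y \<in> lattice_of A \<Longrightarrow> x - y \<in> lattice_of A"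
  using lattice_of_add[OF _ lattice_of_uminus] by fastforce

lemma countable_lattice_of: "countable (lattice_of A)"
  unfolding lattice_of_def by (intro countable_image countable_vector) (simp add: Ints_def)

lemma matrix_inv_mult:
  assumes "invertible A"
  shows "A ** matrix_inv A = mat 1" "matrix_inv A ** A = mat 1"
  using someI_ex[OF assms[unfolded invertible_def]] by (simp_all add: matrix_inv_def)

lemma emeasure_lebesgue_translation:
  fixes S :: "'a::euclidean_space set"
  shows "emeasure lebesgue {x. x - a \<in> S} = emeasure lebesgue S"
proof -
  have "{x. x - a \<in> S} = (\<lambda>x. a + 1 *\<^sub>R x) ` S" by (auto intro!: image_eqI[of _ _ "_ - a"])
  then show ?thesis using emeasure_lebesgue_affine[of 1 a S] by (simp add: add.commute)
qed

lemma sets_lebesgue_translation: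
  fixes S :: "'a::euclidean_space set"
  assumes "S \<in> sets lebesgue"
  shows "{x. x - a \<in> S} \<in> sets lebesgue"
proof -
  have "{x. x - a \<in> S} = (\<lambda>x. a + x) ` S" by (auto intro!: image_eqI[of _ _ "_ - a"])
  then show ?thesis using lebesgue_sets_translation[OF assms] by simp
qed

section \<open>Characters of the real space\<close>

definition lattice_char :: "real^'n \<Rightarrow> real^'n \<Rightarrow> complex" where
  "lattice_char \<kappa> x = cis (2 * pi * (\<kappa> \<bullet> x))"

lemma norm_lattice_char [simp]: "cmod (lattice_char \<kappa> x) = 1"
  by (simp add: lattice_char_def)

lemma lattice_char_add_right: "lattice_char \<kappa> (x + y) = lattice_char \<kappa> x * lattice_char \<kappa> y"
  by (simp add: lattice_char_def cis_mult inner_add_right distrib_left)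

lemma lattice_char_add_left: "lattice_char (\<kappa> + \<mu>) x = lattice_char \<kappa> x * lattice_char \<mu> x"
  by (simp add: lattice_char_def cis_mult inner_add_left distrib_left)

lemma cnj_lattice_char: "cnj (lattice_char \<kappa> x) = lattice_char (- \<kappa>) x"
  by (simp add: lattice_char_def cis_cnj)

lemma lattice_char_zero_left [simp]: "lattice_char 0 x = 1"
  by (simp add: lattice_char_def)

lemma continuous_on_lattice_char [continuous_intros]: "continuous_on S (lattice_char \<kappa>)"
  unfolding lattice_char_def[abs_def] cis_conv_exp by (intro continuous_intros)

lemma lattice_char_eq_1_iff: "lattice_char \<kappa> x = 1 \<longleftrightarrow> \<kappa> \<bullet> x \<in> \<int>"
proof
  assume "lattice_char \<kappa> x = 1"
  then have "cos (2 * pi * (\<kappa> \<bullet> x)) = 1" by (simp add: lattice_char_def complex_eq_iff)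
  then obtain n :: int where "2 * pi * (\<kappa> \<bullet> x) = of_int n * 2 * pi"
    unfolding cos_one_2pi_int by blast
  then show "\<kappa> \<bullet> x \<in> \<int>" by simp
next
  assume "\<kappa> \<bullet> x \<in> \<int>"
  then show "lattice_char \<kappa> x = 1" by (simp add: lattice_char_def cis_multiple_2pi)
qed

lemma norm_lattice_char_minus_1: "cmod (lattice_char \<kappa> h - 1) = 2 * \<bar>sin (pi * (\<kappa> \<bullet> h))\<bar>"
  using dist_exp_i_1[of "2 * pi * (\<kappa> \<bullet> h)"] by (simp add: lattice_char_def cis_conv_exp)

section \<open>Lattice duality, representatives and the size of a fundamental domain\<close>

locale lattice_domain =
  fixes A :: "real^'n^'n" and \<Omega> :: "(real^'n) set"
  assumes inv: "invertible A" and fd: "fundamental_domain (lattice_of A) \<Omega>"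
begin

abbreviation "L \<equiv> lattice_of A"

abbreviation "D \<equiv> dual_lattice A"

text \<open>The transpose moves across the inner product and cancels the inverse transpose, leaving
  the inner product of two integer vectors.\<close>

lemma dual_inner_lattice:
  assumes "\<kappa> \<in> D" "l \<in> L" shows "\<kappa> \<bullet> l \<in> \<int>"
proof -
  let ?B = "matrix_inv (transpose A)"
  obtain z w where z: "\<kappa> = ?B *v z" "\<forall>i. z $ i \<in> \<int>" and w: "l = A *v w" "\<forall>i. w $ i \<in> \<int>"
    using assms by (auto simp: dual_lattice_def lattice_of_def)
  have "\<kappa> \<bullet> l = (transpose A *v (?B *v z)) \<bullet> w"
    by (simp add: z w transpose_matrix_vector flip: dot_lmul_matrix)
  also have "\<dots> = z \<bullet> w"
    using matrix_inv_mult(1)[of "transpose A"] inv by (simp add: matrix_vector_mul_assoc transpose_invertible)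
  also have "\<dots> \<in> \<int>" using z w by (auto simp: inner_vec_def intro!: Ints_sum Ints_mult)
  finally show ?thesis .
qed

text \<open>Pairing x with the dual basis vector number i returns coordinate i of x in the lattice
  basis. This converse of duality provides enough characters to separate the points of
  \<Omega>.\<close>

lemma lattice_of_dual_separates:
  assumes "\<And>\<kappa>. \<kappa> \<in> D \<Longrightarrow> \<kappa> \<bullet> x \<in> \<int>" shows "x \<in> L"
proof -
  let ?B = "matrix_inv (transpose A)"
  define y where "y = matrix_inv A *v x"
  have x: "x = A *v y" using matrix_inv_mult(1)[OF inv] by (simp add: y_def matrix_vector_mul_assoc)
  have "y $ i \<in> \<int>" for i
  proof -
    have "?B *v axis i 1 \<in> D" by (auto simp: dual_lattice_def lattice_of_def axis_def)
    then have "(?B *v axis i 1) \<bullet> x \<in> \<int>" by (rule assms)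
    also have "(?B *v axis i 1) \<bullet> x = (transpose A *v (?B *v axis i 1)) \<bullet> y"
      by (simp add: x transpose_matrix_vector flip: dot_lmul_matrix)
    also have "\<dots> = y $ i"
      using matrix_inv_mult(1)[of "transpose A"] inv
      by (simp add: matrix_vector_mul_assoc transpose_invertible inner_axis')
    finally show ?thesis .
  qed
  then show ?thesis by (auto simp: x lattice_of_def)
qed

lemma dual_zero: "0 \<in> D" and dual_add: "\<kappa> \<in> D \<Longrightarrow> \<mu> \<in> D \<Longrightarrow> \<kappa> + \<mu> \<in> D"
  and dual_uminus: "\<kappa> \<in> D \<Longrightarrow> - \<kappa> \<in> D" and dual_diff: "\<kappa> \<in> D \<Longrightarrow> \<mu> \<in> D \<Longrightarrow> \<kappa> - \<mu> \<in> D"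
  by (simp_all add: dual_lattice_def lattice_of_zero lattice_of_add lattice_of_uminus lattice_of_diff)

lemma lattice_char_periodic: "\<kappa> \<in> D \<Longrightarrow> l \<in> L \<Longrightarrow> lattice_char \<kappa> (x + l) = lattice_char \<kappa> x"
  using dual_inner_lattice by (simp add: lattice_char_add_right lattice_char_eq_1_iff)

lemma sets_Omega [measurable]: "\<Omega> \<in> sets lebesgue"
  using fd by (simp add: fundamental_domain_def)

lemma Omega_unique: "\<omega> \<in> \<Omega> \<Longrightarrow> \<omega>' \<in> \<Omega> \<Longrightarrow> l \<in> L \<Longrightarrow> l' \<in> L \<Longrightarrow> \<omega> + l = \<omega>' + l' \<Longrightarrow> \<omega> = \<omega>' \<and> l = l'"
  using fd by (auto simp: fundamental_domain_def bij_betw_def inj_on_def)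

lemma Omega_cover: obtains \<omega> l where "\<omega> \<in> \<Omega>" "l \<in> L" "x = \<omega> + l"
proof -
  have "x \<in> (\<lambda>(\<omega>, l). \<omega> + l) ` (\<Omega> \<times> L)" using fd by (simp add: fundamental_domain_def bij_betw_def)
  then show ?thesis using that by auto
qed

text \<open>The description is the one inside \<open>periodic_ext\<close>, so the periodic extension
  unfolds to composition with \<open>rep\<close>.\<close>

definition rep :: "real^'n \<Rightarrow> real^'n" where
  "rep x = (THE \<omega>. \<omega> \<in> \<Omega> \<and> x - \<omega> \<in> L)"

lemma rep_eqI:
  assumes "\<omega> \<in> \<Omega>" "x - \<omega> \<in> L" shows "rep x = \<omega>"
  unfolding rep_def
proof (rule the_equality)
  fix \<omega>' assume "\<omega>' \<in> \<Omega> \<and> x - \<omega>' \<in> L"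
  then show "\<omega>' = \<omega>" using Omega_unique[of \<omega>' \<omega> "x - \<omega>'" "x - \<omega>"] assms by simp
qed (use assms in simp)

lemma rep_in: "rep x \<in> \<Omega>" and diff_rep_in: "x - rep x \<in> L"
proof -
  obtain \<omega> l where *: "\<omega> \<in> \<Omega>" "l \<in> L" "x = \<omega> + l" by (rule Omega_cover)
  then have "rep x = \<omega>" by (intro rep_eqI) auto
  with * show "rep x \<in> \<Omega>" "x - rep x \<in> L" by auto
qed

lemma periodic_ext_eq: "periodic_ext L \<Omega> f x = f (rep x)"
  by (simp add: periodic_ext_def rep_def)

lemma lattice_char_rep: "\<kappa> \<in> D \<Longrightarrow> lattice_char \<kappa> (rep x) = lattice_char \<kappa> x"
  using lattice_char_periodic[OF _ diff_rep_in, of \<kappa> "rep x" x] by simp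

text \<open>The translates of \<open>\<Omega>\<close> tile the space; moving each tile of \<open>S\<close> back into \<open>\<Omega>\<close> preserves the measure.\<close>

lemma emeasure_periodised:
  assumes S: "S \<in> sets lebesgue"
  shows "(\<integral>\<^sup>+l. emeasure lebesgue (\<Omega> \<inter> {x. x - - l \<in> S}) \<partial>count_space L) = emeasure lebesgue S"
proof -
  have un: "(\<Union>l\<in>L. {x. x - l \<in> \<Omega>} \<inter> S) = S"
  proof -
    have "\<exists>l\<in>L. x - l \<in> \<Omega>" for x using Omega_cover[of x] by (metis add_diff_cancel_right')
    then show ?thesis by auto
  qed
  have "(\<integral>\<^sup>+l. emeasure lebesgue (\<Omega> \<inter> {x. x - - l \<in> S}) \<partial>count_space L)
      = (\<integral>\<^sup>+l. emeasure lebesgue ({x. x - l \<in> \<Omega>} \<inter> S) \<partial>count_space L)"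
  proof (intro nn_integral_cong)
    fix l
    have "{x. x - l \<in> \<Omega> \<inter> {x. x - - l \<in> S}} = {x. x - l \<in> \<Omega>} \<inter> S" by auto
    then show "emeasure lebesgue (\<Omega> \<inter> {x. x - - l \<in> S}) = emeasure lebesgue ({x. x - l \<in> \<Omega>} \<inter> S)"
      using emeasure_lebesgue_translation[of l "\<Omega> \<inter> {x. x - - l \<in> S}"] by simp
  qed
  also have "\<dots> = emeasure lebesgue (\<Union>l\<in>L. {x. x - l \<in> \<Omega>} \<inter> S)"
  proof (intro emeasure_UN_countable[symmetric] countable_lattice_of)
    show "{x. x - l \<in> \<Omega>} \<inter> S \<in> sets lebesgue" for l
      by (intro sets.Int sets_lebesgue_translation S sets_Omega)
    show "disjoint_family_on (\<lambda>l. {x. x - l \<in> \<Omega>} \<inter> S) L"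
    proof (unfold disjoint_family_on_def, intro ballI impI)
      fix l m assume lm: "l \<in> L" "m \<in> L" "l \<noteq> m"
      have False if "x - l \<in> \<Omega>" "x - m \<in> \<Omega>" for x
        using Omega_unique[OF that lm(1,2)] lm(3) by simp
      then show "{x. x - l \<in> \<Omega>} \<inter> S \<inter> ({x. x - m \<in> \<Omega>} \<inter> S) = {}" by blast
    qed
  qed
  finally show ?thesis unfolding un .
qed

text \<open>Every point of \<Omega> is carried by some lattice vector into the closed cell Q. The
  parts of \<Omega> carried into Q by the various vectors cover \<Omega>, and by the tiling identity
  with S = Q their measures add up to |Q| < \<infinity>.\<close>

lemma lmeasurable_Omega: "\<Omega> \<in> lmeasurable"
proof -
  define Q where "Q = (\<lambda>z. A *v z) ` cbox 0 (\<chi> i. 1)"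
  have "compact Q" unfolding Q_def
    by (intro compact_continuous_image compact_cbox continuous_intros linear_continuous_on)
       (simp add: matrix_vector_mul_bounded_linear)
  then have Q: "Q \<in> lmeasurable" by (rule lmeasurable_compact)
  have cover: "\<exists>l\<in>L. x + l \<in> Q" for x
  proof -
    define y where "y = matrix_inv A *v x"
    \<comment> \<open>Adding w replaces the lattice coordinates of x by their fractional
      parts.\<close>
    define w where "w = (\<chi> i. - real_of_int \<lfloor>y $ i\<rfloor>)"
    have x: "x = A *v y" using matrix_inv_mult(1)[OF inv] by (simp add: y_def matrix_vector_mul_assoc)
    have "x + A *v w = A *v (y + w)" by (simp add: x matrix_vector_right_distrib)
    moreover have "y + w \<in> cbox 0 (\<chi> i. 1)"
      unfolding mem_box_cart w_def by (auto, linarith)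
    moreover have "A *v w \<in> L" by (auto simp: lattice_of_def w_def)
    ultimately show ?thesis unfolding Q_def by auto
  qed
  \<comment> \<open>The double minus puts the condition that x + l lies in Q into the form used by
    the translation lemmas.\<close>
  have Qs: "\<Omega> \<inter> {x. x - - l \<in> Q} \<in> sets lebesgue" for l
    using Q by (intro sets.Int sets_Omega sets_lebesgue_translation) (auto simp: fmeasurable_def)
  have "\<Omega> = (\<Union>l\<in>L. \<Omega> \<inter> {x. x - - l \<in> Q})" using cover by auto
  then have "emeasure lebesgue \<Omega> = emeasure lebesgue (\<Union>l\<in>L. \<Omega> \<inter> {x. x - - l \<in> Q})" by simp
  also have "\<dots> \<le> (\<integral>\<^sup>+l. emeasure lebesgue (\<Omega> \<inter> {x. x - - l \<in> Q}) \<partial>count_space L)"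
  proof -
    \<comment> \<open>Countable subadditivity over the index set L, by counting: a point of the
      union lies in at least one piece. Overlaps along the faces of Q are harmless, as only an upper
      bound is wanted.\<close>
    have "emeasure lebesgue (\<Union>l\<in>L. \<Omega> \<inter> {x. x - - l \<in> Q})
        = (\<integral>\<^sup>+x. indicator (\<Union>l\<in>L. \<Omega> \<inter> {x. x - - l \<in> Q}) x \<partial>lebesgue)"
      using Qs by (intro nn_integral_indicator[symmetric] sets.countable_UN' countable_lattice_of) auto
    also have "\<dots> \<le> (\<integral>\<^sup>+x. (\<integral>\<^sup>+l. indicator (\<Omega> \<inter> {x. x - - l \<in> Q}) x \<partial>count_space L) \<partial>lebesgue)"
    proof (intro nn_integral_mono)
      fix x
      show "indicator (\<Union>l\<in>L. \<Omega> \<inter> {x. x - - l \<in> Q}) x \<le> (\<integral>\<^sup>+l. indicator (\<Omega> \<inter> {x. x - - l \<in> Q}) x \<partial>count_space L)"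
      proof (cases "x \<in> (\<Union>l\<in>L. \<Omega> \<inter> {x. x - - l \<in> Q})")
        case True
        then obtain l where l: "l \<in> L" "x \<in> \<Omega> \<inter> {x. x - - l \<in> Q}" by blast
        have "(\<integral>\<^sup>+m. indicator {l} m \<partial>count_space L) \<le> (\<integral>\<^sup>+l. indicator (\<Omega> \<inter> {x. x - - l \<in> Q}) x \<partial>count_space L)"
          using l by (intro nn_integral_mono) (auto simp: indicator_def)
        moreover have "(\<integral>\<^sup>+m. indicator {l} m \<partial>count_space L) = 1" using l by simp
        ultimately show ?thesis using True by simp
      qed simp
    qed
    also have "\<dots> = (\<integral>\<^sup>+l. (\<integral>\<^sup>+x. indicator (\<Omega> \<inter> {x. x - - l \<in> Q}) x \<partial>lebesgue) \<partial>count_space L)"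
      using Qs by (intro nn_integral_count_space_nn_integral countable_lattice_of) auto
    finally show ?thesis using Qs by simp
  qed
  also have "\<dots> = emeasure lebesgue Q" using Q by (intro emeasure_periodised) auto
  also have "\<dots> < \<infinity>" using Q by (simp only: fmeasurable_def mem_Collect_eq infinity_ennreal_def)
  finally show ?thesis by (simp add: fmeasurable_def)
qed

text \<open>If \<Omega> were null, so would be the whole space, being a countable union of
  translates of \<Omega>.\<close>

lemma measure_Omega_pos: "measure lebesgue \<Omega> > 0"
proof -
  have "emeasure lebesgue \<Omega> \<noteq> 0"
  proof
    assume 0: "emeasure lebesgue \<Omega> = 0"
    have "emeasure lebesgue (\<Omega> \<inter> {x. x - - l \<in> UNIV}) = 0" for l
      using 0 by simp
    then have "emeasure lebesgue (UNIV :: (real^'n) set) = 0"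
      using emeasure_periodised[of UNIV] by simp
    then show False by simp
  qed
  then show ?thesis using lmeasurable_Omega by (simp add: emeasure_eq_measure2 zero_less_measure_iff)
qed

section \<open>The normalised measure and translations modulo the lattice\<close>

abbreviation "M \<equiv> normalised_measure \<Omega>"

lemma space_M [simp]: "space M = \<Omega>"
  using sets_Omega by (auto simp: normalised_measure_def space_restrict_space)

lemma sets_M [measurable_cong]: "sets M = sets (lebesgue_on \<Omega>)"
  by (simp add: normalised_measure_def)

lemma sets_M_iff: "B \<in> sets M \<longleftrightarrow> B \<in> sets lebesgue \<and> B \<subseteq> \<Omega>"
  using sets_Omega by (simp add: sets_M sets_restrict_space_iff conj_commute)

lemma emeasure_lebesgue_on_Omega: "emeasure (lebesgue_on \<Omega>) \<Omega> = ennreal (measure lebesgue \<Omega>)"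
  using lmeasurable_Omega by (simp add: emeasure_restrict_space emeasure_eq_measure2)

lemma emeasure_M: "B \<in> sets M \<Longrightarrow> emeasure M B = emeasure lebesgue B / ennreal (measure lebesgue \<Omega>)"
  using sets_Omega unfolding sets_M_iff normalised_measure_def
  by (subst emeasure_uniform_measure)
     (auto simp: sets_restrict_space_iff emeasure_restrict_space emeasure_lebesgue_on_Omega Int_absorb1)

lemma M_eq_density: "M = density (lebesgue_on \<Omega>) (\<lambda>x. ennreal (1 / measure lebesgue \<Omega>))"
proof -
  have "1 / ennreal (measure lebesgue \<Omega>) = ennreal (1 / measure lebesgue \<Omega>)"
    using measure_Omega_pos by (simp add: divide_ennreal flip: ennreal_1)
  then show ?thesis
    unfolding normalised_measure_def uniform_measure_def emeasure_lebesgue_on_Omega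
    by (intro density_cong) (auto intro!: AE_I2 borel_measurable_divide_ennreal borel_measurable_indicator simp: sets_restrict_space_iff)
qed

lemma integral_M:
  fixes f :: "real^'n \<Rightarrow> 'b::{banach, second_countable_topology}"
  assumes "f \<in> borel_measurable M"
  shows "(\<integral>x. f x \<partial>M) = (1 / measure lebesgue \<Omega>) *\<^sub>R (\<integral>x. f x \<partial>lebesgue_on \<Omega>)"
proof -
  have "f \<in> borel_measurable (lebesgue_on \<Omega>)" using assms by (simp add: measurable_cong_sets[OF sets_M refl])
  then show ?thesis
    using measure_Omega_pos unfolding M_eq_density by (subst integral_density) auto
qed

sublocale prob_space M
  unfolding normalised_measure_def
  using measure_Omega_pos by (intro prob_space_uniform_measure) (simp_all add: emeasure_lebesgue_on_Omega)

text \<open>Translation by h on the quotient by L, read on representatives in \<Omega>.\<close>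

definition shift :: "real^'n \<Rightarrow> real^'n \<Rightarrow> real^'n" where
  "shift h x = rep (x + h)"

lemma shift_vimage:
  assumes "B \<subseteq> \<Omega>"
  shows "shift h -` B \<inter> \<Omega> = (\<Union>l\<in>L. \<Omega> \<inter> {x. x - - l \<in> {y. y - - h \<in> B}})"
proof (intro set_eqI iffI)
  fix x assume "x \<in> shift h -` B \<inter> \<Omega>"
  moreover have "rep (x + h) - (x + h) \<in> L" using lattice_of_uminus[OF diff_rep_in[of "x + h"]] by simp
  ultimately show "x \<in> (\<Union>l\<in>L. \<Omega> \<inter> {x. x - - l \<in> {y. y - - h \<in> B}})"
    by (intro UN_I[of "rep (x + h) - (x + h)"]) (auto simp: shift_def)
next
  fix x assume "x \<in> (\<Union>l\<in>L. \<Omega> \<inter> {x. x - - l \<in> {y. y - - h \<in> B}})"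
  then obtain l where l: "l \<in> L" "x \<in> \<Omega>" "x + l + h \<in> B" by auto
  have "rep (x + h) = x + l + h"
    using l assms lattice_of_uminus[OF l(1)] by (intro rep_eqI) auto
  then show "x \<in> shift h -` B \<inter> \<Omega>" using l by (simp add: shift_def)
qed

lemma shift_measurable [measurable]: "shift h \<in> measurable M M"
proof (rule measurableI)
  fix B assume "B \<in> sets M"
  then have B: "B \<in> sets lebesgue" "B \<subseteq> \<Omega>" by (auto simp: sets_M_iff)
  have "(\<Union>l\<in>L. \<Omega> \<inter> {x. x - - l \<in> {y. y - - h \<in> B}}) \<in> sets lebesgue"
    by (intro sets.countable_UN' countable_lattice_of image_subsetI sets.Int sets_Omega sets_lebesgue_translation B)
  moreover have "(\<Union>l\<in>L. \<Omega> \<inter> {x. x - - l \<in> {y. y - - h \<in> B}}) \<subseteq> \<Omega>" by blast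
  ultimately show "shift h -` B \<inter> space M \<in> sets M"
    unfolding space_M shift_vimage[OF B(2)] sets_M_iff ..
qed (simp add: shift_def rep_in)

text \<open>This is the translation invariance of Haar measure on the torus. The preimage of B
  splits according to the lattice vector that brings x + h back into \<Omega>; the pieces are
  disjoint because B lies in \<Omega>, and the tiling identity for the translate B - h sums them to
  |B - h| = |B|.\<close>

lemma distr_shift: "distr M M (shift h) = M"
proof (rule measure_eqI)
  fix B assume "B \<in> sets (distr M M (shift h))"
  then have BM: "B \<in> sets M" by simp
  then have B: "B \<in> sets lebesgue" "B \<subseteq> \<Omega>" by (auto simp: sets_M_iff)
  let ?S = "{y. y - - h \<in> B}"
  have S: "?S \<in> sets lebesgue" using B by (intro sets_lebesgue_translation)
  have "emeasure lebesgue (\<Union>l\<in>L. \<Omega> \<inter> {x. x - - l \<in> ?S}) = (\<integral>\<^sup>+l. emeasure lebesgue (\<Omega> \<inter> {x. x - - l \<in> ?S}) \<partial>count_space L)"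
  proof (intro emeasure_UN_countable countable_lattice_of)
    show "\<Omega> \<inter> {x. x - - l \<in> ?S} \<in> sets lebesgue" for l
      by (intro sets.Int sets_Omega sets_lebesgue_translation S)
    show "disjoint_family_on (\<lambda>l. \<Omega> \<inter> {x. x - - l \<in> ?S}) L"
    proof (unfold disjoint_family_on_def, intro ballI impI)
      fix l m assume lm: "l \<in> L" "m \<in> L" "l \<noteq> m"
      have False if "x + l + h \<in> B" "x + m + h \<in> B" for x
        using Omega_unique[of "x + l + h" "x + m + h" "- l" "- m"] that B lm lattice_of_uminus by auto
      then show "\<Omega> \<inter> {x. x - - l \<in> ?S} \<inter> (\<Omega> \<inter> {x. x - - m \<in> ?S}) = {}" by auto
    qed
  qed
  also have "\<dots> = emeasure lebesgue ?S" by (rule emeasure_periodised[OF S])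
  also have "\<dots> = emeasure lebesgue B" by (rule emeasure_lebesgue_translation)
  finally have "emeasure lebesgue (shift h -` B \<inter> \<Omega>) = emeasure lebesgue B"
    using shift_vimage[OF B(2)] by simp
  moreover have "shift h -` B \<inter> \<Omega> \<in> sets M" using measurable_sets[OF shift_measurable BM, of h] by simp
  ultimately show "emeasure (distr M M (shift h)) B = emeasure M B"
    using BM by (simp add: emeasure_distr emeasure_M)
qed simp

lemma integral_shift:
  fixes f :: "real^'n \<Rightarrow> 'b::{banach, second_countable_topology}"
  assumes "f \<in> borel_measurable M"
  shows "(\<integral>x. f (shift h x) \<partial>M) = (\<integral>x. f x \<partial>M)"
  using integral_distr[OF shift_measurable assms, of h] by (simp add: distr_shift)

lemma integrable_shift:
  fixes f :: "real^'n \<Rightarrow> 'b::{banach, second_countable_topology}"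
  assumes "integrable M f" shows "integrable M (\<lambda>x. f (shift h x))"
  using integrable_distr[OF shift_measurable, of h f] assms by (simp add: distr_shift)

lemma lattice_char_shift: "\<kappa> \<in> D \<Longrightarrow> lattice_char \<kappa> (shift h x) = lattice_char \<kappa> x * lattice_char \<kappa> h"
  by (simp add: shift_def lattice_char_rep lattice_char_add_right)

lemma continuous_measurable_M:
  assumes "continuous_on UNIV f" shows "f \<in> borel_measurable M"
proof -
  have "f \<in> borel_measurable (lebesgue_on \<Omega>)"
    using assms sets_Omega by (intro continuous_imp_measurable_on_sets_lebesgue continuous_on_subset[OF assms]) auto
  then show ?thesis by (simp add: measurable_cong_sets[OF sets_M refl])
qed

lemma lattice_char_measurable [measurable]: "lattice_char \<kappa> \<in> borel_measurable M"
  by (intro continuous_measurable_M continuous_intros)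

lemma integral_lattice_char:
  assumes "\<kappa> \<in> D" shows "(\<integral>x. lattice_char \<kappa> x \<partial>M) = (if \<kappa> = 0 then 1 else 0)"
proof (cases "\<kappa> = 0")
  case True
  then show ?thesis using prob_space by simp
next
  case False
  \<comment> \<open>Chosen so that \<kappa> \<bullet> h = 1/2: translation by h reverses the sign of
    the character but keeps its integral, which therefore vanishes.\<close>
  define h where "h = (1 / (2 * (\<kappa> \<bullet> \<kappa>))) *\<^sub>R \<kappa>"
  have "lattice_char \<kappa> h = -1" using False by (simp add: lattice_char_def h_def cis_pi)
  then have "(\<integral>x. lattice_char \<kappa> x \<partial>M) = (\<integral>x. - lattice_char \<kappa> x \<partial>M)"
    using assms integral_shift[OF lattice_char_measurable, of \<kappa> h] by (simp add: lattice_char_shift)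
  then show ?thesis using False by simp
qed

sublocale orthonormal_system M lattice_char D
proof
  show "L2 (lattice_char \<kappa>)" for \<kappa> by (intro L2_bounded[where B = 1]) auto
  show "(\<integral>x. lattice_char \<kappa> x * cnj (lattice_char \<mu> x) \<partial>M) = (if \<kappa> = \<mu> then 1 else 0)"
    if "\<kappa> \<in> D" "\<mu> \<in> D" for \<kappa> \<mu>
    using integral_lattice_char[OF dual_diff[OF that]]
    by (simp add: cnj_lattice_char flip: lattice_char_add_left)
qed

lemma coeff_eq_fourier_coeff:
  assumes [measurable]: "f \<in> borel_measurable M"
  shows "coeff f \<kappa> = fourier_coeff \<Omega> f \<kappa>"
proof -
  have eq: "cnj (lattice_char \<kappa> x) = exp (- 2 * complex_of_real pi * \<i> * complex_of_real (\<kappa> \<bullet> x))" for x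
    unfolding lattice_char_def cis_cnj unfolding cis_conv_exp by (simp add: mult_ac)
  have "(\<lambda>x. f x * cnj (lattice_char \<kappa> x)) \<in> borel_measurable M"
    unfolding cnj_lattice_char by measurable
  from integral_M[OF this] show ?thesis
    by (simp add: coeff_def fourier_coeff_def eq scaleR_conv_of_real)
qed

lemma L2_shift: "L2 f \<Longrightarrow> L2 (\<lambda>x. f (shift h x))"
  using integrable_shift[of "\<lambda>x. (cmod (f x))\<^sup>2" h] by (auto simp: L2_def)

lemma coeff_shift:
  assumes f: "L2 f" and \<kappa>: "\<kappa> \<in> D"
  shows "coeff (\<lambda>x. f (shift h x)) \<kappa> = lattice_char \<kappa> h * coeff f \<kappa>"
proof -
  have [measurable]: "f \<in> borel_measurable M" using f by (simp add: L2_def)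
  have 1: "cmod (lattice_char \<kappa> h) = 1" by simp
  have "lattice_char \<kappa> h * cnj (lattice_char \<kappa> h) = 1"
    using 1 by (simp only: complex_norm_square[symmetric]) simp
  \<comment> \<open>The translation multiplies the character by a constant of modulus 1. Pulling
    that constant out leaves an integrand that depends on \<open>shift h x\<close> alone, and
    invariance then removes the shift.\<close>
  then have eq: "f (shift h x) * cnj (lattice_char \<kappa> x)
      = lattice_char \<kappa> h * (f (shift h x) * cnj (lattice_char \<kappa> (shift h x)))" for x
    using \<kappa> by (simp add: lattice_char_shift mult_ac)
  have "(\<lambda>x. f x * cnj (lattice_char \<kappa> x)) \<in> borel_measurable M"
    unfolding cnj_lattice_char by measurable
  from integral_shift[OF this, of h] show ?thesis
    unfolding coeff_def eq integral_mult_right_zero by simp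
qed

lemma coeff_difference:
  assumes f: "L2 f" and \<kappa>: "\<kappa> \<in> D"
  shows "coeff (\<lambda>x. f (shift h x) - f x) \<kappa> = (lattice_char \<kappa> h - 1) * coeff f \<kappa>"
proof -
  have "coeff (\<lambda>x. f (shift h x) - f x) \<kappa> = coeff (\<lambda>x. f (shift h x)) \<kappa> - coeff f \<kappa>"
    unfolding coeff_def left_diff_distrib using f \<kappa> L2_e L2_shift
    by (intro Bochner_Integration.integral_diff L2_mult_cnj_integrable) auto
  then show ?thesis using coeff_shift[OF f \<kappa>, of h] by (simp add: algebra_simps)
qed

section \<open>Density of trigonometric polynomials\<close>

text \<open>Building up one term at a time gives all closure properties by rule induction; the
  explicit finite sum with distinct frequencies is recovered in \<open>trig_eq_sum\<close>.\<close>

inductive trig :: "(real^'n \<Rightarrow> complex) \<Rightarrow> bool" where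
  trig_zero: "trig (\<lambda>x. 0)"
| trig_step: "\<kappa> \<in> D \<Longrightarrow> trig p \<Longrightarrow> trig (\<lambda>x. c * lattice_char \<kappa> x + p x)"

lemma trig_add: "trig p \<Longrightarrow> trig q \<Longrightarrow> trig (\<lambda>x. p x + q x)"
  by (induction rule: trig.induct) (auto simp: add.assoc intro: trig_step)

lemma trig_char: "\<kappa> \<in> D \<Longrightarrow> trig (\<lambda>x. c * lattice_char \<kappa> x)"
  using trig_step[OF _ trig_zero] by simp

lemma trig_const: "trig (\<lambda>x. c)"
  using trig_char[OF dual_zero, of c] by simp

lemma trig_char_mult: "trig p \<Longrightarrow> \<kappa> \<in> D \<Longrightarrow> trig (\<lambda>x. c * lattice_char \<kappa> x * p x)"
proof (induction rule: trig.induct)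
  case trig_zero
  then show ?case by (simp add: trig.trig_zero)
next
  case (trig_step \<mu> p d)
  have "trig (\<lambda>x. (c * d) * lattice_char (\<kappa> + \<mu>) x + c * lattice_char \<kappa> x * p x)"
    using trig_step by (intro trig.trig_step dual_add) auto
  then show ?case by (simp add: lattice_char_add_left algebra_simps)
qed

lemma trig_mult: "trig p \<Longrightarrow> trig q \<Longrightarrow> trig (\<lambda>x. p x * q x)"
proof (induction rule: trig.induct)
  case trig_zero
  then show ?case by (simp add: trig.trig_zero)
next
  case (trig_step \<mu> p d)
  then show ?case using trig_add[OF trig_char_mult[of q \<mu> d]] by (simp add: distrib_right)
qed

lemma continuous_on_trig: "trig p \<Longrightarrow> continuous_on S p"
  by (induction rule: trig.induct) (auto intro!: continuous_intros)

lemma trig_bounded: "trig p \<Longrightarrow> \<exists>B. \<forall>x. cmod (p x) \<le> B"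
proof (induction rule: trig.induct)
  case trig_zero
  then show ?case by (intro exI[of _ 0]) simp
next
  case (trig_step \<kappa> p c)
  then obtain B where B: "\<And>x. cmod (p x) \<le> B" by blast
  have "cmod (c * lattice_char \<kappa> x + p x) \<le> cmod c + B" for x
    using norm_triangle_ineq[of "c * lattice_char \<kappa> x" "p x"] B[of x] by (simp add: norm_mult)
  then show ?case by blast
qed

lemma trig_eq_sum: "trig p \<Longrightarrow> \<exists>S c. finite S \<and> S \<subseteq> D \<and> p = (\<lambda>x. \<Sum>\<kappa>\<in>S. c \<kappa> * lattice_char \<kappa> x)"
proof (induction rule: trig.induct)
  case trig_zero
  then show ?case by (intro exI[of _ "{}"]) simp
next
  case (trig_step \<mu> p d)
  then obtain S c where S: "finite S" "S \<subseteq> D" and p: "p = (\<lambda>x. \<Sum>\<kappa>\<in>S. c \<kappa> * lattice_char \<kappa> x)" by blast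
  \<comment> \<open>The frequency \<mu> may already occur in S, in which case its two coefficients
    are added.\<close>
  define c' where "c' \<kappa> = (if \<kappa> = \<mu> then d else 0) + (if \<kappa> \<in> S then c \<kappa> else 0)" for \<kappa>
  have "d * lattice_char \<mu> x + p x = (\<Sum>\<kappa>\<in>insert \<mu> S. c' \<kappa> * lattice_char \<kappa> x)" for x
  proof -
    have "(\<Sum>\<kappa>\<in>insert \<mu> S. c' \<kappa> * lattice_char \<kappa> x)
        = (\<Sum>\<kappa>\<in>insert \<mu> S. (if \<kappa> = \<mu> then d * lattice_char \<kappa> x else 0))
        + (\<Sum>\<kappa>\<in>insert \<mu> S. (if \<kappa> \<in> S then c \<kappa> * lattice_char \<kappa> x else 0))"
      unfolding sum.distrib[symmetric] by (intro sum.cong) (auto simp: c'_def distrib_right)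
    also have "(\<Sum>\<kappa>\<in>insert \<mu> S. (if \<kappa> \<in> S then c \<kappa> * lattice_char \<kappa> x else 0)) = p x"
      unfolding p using S by (intro sum.mono_neutral_cong_right) auto
    finally show ?thesis using S by simp
  qed
  with S trig_step.hyps show ?case by (intro exI[of _ "insert \<mu> S"] exI[of _ c']) auto
qed

lemma L2_trig:
  assumes "trig p" shows "L2 p"
proof -
  obtain B where "\<And>x. cmod (p x) \<le> B" using trig_bounded[OF assms] by blast
  then show ?thesis using continuous_measurable_M[OF continuous_on_trig[OF assms]] L2_bounded by blast
qed

text \<open>These functions form the real algebra to which Stone-Weierstrass is applied.\<close>

definition real_trig :: "(real^'n \<Rightarrow> real) \<Rightarrow> bool" where
  "real_trig g \<longleftrightarrow> trig (\<lambda>x. complex_of_real (g x))"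

lemma real_trig_const: "real_trig (\<lambda>x. c)"
  and real_trig_add: "real_trig f \<Longrightarrow> real_trig g \<Longrightarrow> real_trig (\<lambda>x. f x + g x)"
  and real_trig_mult: "real_trig f \<Longrightarrow> real_trig g \<Longrightarrow> real_trig (\<lambda>x. f x * g x)"
  by (auto simp: real_trig_def intro: trig_const trig_add trig_mult)

lemma continuous_on_real_trig:
  assumes "real_trig g" shows "continuous_on S g"
  using continuous_on_Re[OF continuous_on_trig[OF assms[unfolded real_trig_def]], of S] by simp

lemma real_trig_bounded: "real_trig g \<Longrightarrow> \<exists>B. \<forall>x. \<bar>g x\<bar> \<le> B"
  unfolding real_trig_def by (drule trig_bounded) simp

text \<open>Since D is closed under negation, the conjugate of a character is again a character, and
  real and imaginary parts are combinations of the two.\<close>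

lemma real_trig_Re_char: "\<kappa> \<in> D \<Longrightarrow> real_trig (\<lambda>x. Re (lattice_char \<kappa> x))"
  and real_trig_Im_char: "\<kappa> \<in> D \<Longrightarrow> real_trig (\<lambda>x. Im (lattice_char \<kappa> x))"
proof -
  assume \<kappa>: "\<kappa> \<in> D"
  have "trig (\<lambda>x. 1 / 2 * lattice_char \<kappa> x + 1 / 2 * lattice_char (- \<kappa>) x)"
    using \<kappa> by (intro trig_add trig_char dual_uminus)
  then show "real_trig (\<lambda>x. Re (lattice_char \<kappa> x))"
    unfolding real_trig_def cnj_lattice_char[symmetric]
    by (rule back_subst[of trig]) (auto simp: complex_eq_iff)
  have "trig (\<lambda>x. - \<i> / 2 * lattice_char \<kappa> x + \<i> / 2 * lattice_char (- \<kappa>) x)"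
    using \<kappa> by (intro trig_add trig_char dual_uminus)
  then show "real_trig (\<lambda>x. Im (lattice_char \<kappa> x))"
    unfolding real_trig_def cnj_lattice_char[symmetric]
    by (rule back_subst[of trig]) (auto simp: complex_eq_iff)
qed

text \<open>Two distinct points of \<Omega> differ by a vector outside L, so some dual frequency has
  a non-integral pairing with the difference. Its character takes different values at the two
  points, hence so does its real or its imaginary part.\<close>

lemma real_trig_separates:
  assumes "x \<in> \<Omega>" "y \<in> \<Omega>" "x \<noteq> y"
  shows "\<exists>g. real_trig g \<and> g x \<noteq> g y"
proof -
  have "x - y \<notin> L"
    using Omega_unique[of x y 0 "x - y"] assms lattice_of_zero by auto
  then obtain \<kappa> where \<kappa>: "\<kappa> \<in> D" "\<kappa> \<bullet> (x - y) \<notin> \<int>" using lattice_of_dual_separates by blast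
  then have "lattice_char \<kappa> (x - y) \<noteq> 1" by (simp add: lattice_char_eq_1_iff)
  moreover have "lattice_char \<kappa> x = lattice_char \<kappa> (x - y) * lattice_char \<kappa> y"
    by (simp flip: lattice_char_add_right)
  moreover have "lattice_char \<kappa> y \<noteq> 0" using norm_lattice_char[of \<kappa> y] by (metis norm_zero zero_neq_one)
  ultimately have "lattice_char \<kappa> x \<noteq> lattice_char \<kappa> y" by simp
  then show ?thesis
    using real_trig_Re_char[OF \<kappa>(1)] real_trig_Im_char[OF \<kappa>(1)] by (auto simp: complex_eq_iff)
qed

lemma real_trig_compose_polynomial:
  "real_polynomial_function q \<Longrightarrow> real_trig g \<Longrightarrow> real_trig (\<lambda>x. q (g x))" for q :: "real \<Rightarrow> real"
proof (induction rule: real_polynomial_function.induct)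
  case (linear f)
  then obtain c where "f = (\<lambda>x. x * c)" by (auto simp: real_bounded_linear)
  then show ?case using linear real_trig_mult[OF linear(2) real_trig_const] by simp
qed (auto intro: real_trig_const real_trig_add real_trig_mult)

text \<open>Clamping leaves the algebra, but on the bounded range of g it is a uniform limit of
  polynomials in one variable, and composing g with a polynomial stays in the algebra.\<close>

lemma real_trig_clamp:
  assumes g: "real_trig g" and "\<epsilon> > 0"
  shows "\<exists>p. real_trig p \<and> (\<forall>x. \<bar>max (- B) (min B (g x)) - p x\<bar> < \<epsilon>)"
proof -
  obtain C where C: "\<And>x. \<bar>g x\<bar> \<le> C" using real_trig_bounded[OF g] by blast
  have "continuous_on {-C..C} (\<lambda>t. max (- B) (min B t))" by (intro continuous_intros)
  from Stone_Weierstrass_real_polynomial_function[OF compact_Icc this \<open>\<epsilon> > 0\<close>]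
  obtain q where q: "real_polynomial_function q" "\<And>t. t \<in> {-C..C} \<Longrightarrow> \<bar>max (- B) (min B t) - q t\<bar> < \<epsilon>"
    by metis
  have "g x \<in> {-C..C}" for x using C[of x] by (auto simp: abs_le_iff)
  then show ?thesis using q real_trig_compose_polynomial[OF q(1) g] by blast
qed

text \<open>Inner regularity supplies a closed T at the cost of \<epsilon>/2. As \<Omega> may be
  unbounded, T need not be compact; the other \<epsilon>/2 pays for intersecting it with a large
  ball.\<close>

lemma compact_exhaustion:
  assumes "\<epsilon> > 0"
  obtains K where "compact K" "K \<subseteq> \<Omega>" "K \<in> sets M" "prob (\<Omega> - K) < \<epsilon>"
proof -
  define m where "m = measure lebesgue \<Omega>"
  have m: "m > 0" using measure_Omega_pos by (simp add: m_def)
  have pos: "\<epsilon> / 2 * m > 0" using assms m by simp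
  obtain T where T: "closed T" "T \<subseteq> \<Omega>" "\<Omega> - T \<in> lmeasurable" "emeasure lebesgue (\<Omega> - T) < ennreal (\<epsilon> / 2 * m)"
    by (rule sets_lebesgue_inner_closed[OF sets_Omega pos])
  have Tsets: "T \<inter> cball 0 r \<in> sets M" for r
    using T by (auto simp: sets_M_iff)
  have TM: "T \<in> sets M" using T by (auto simp: sets_M_iff)
  have "measure lebesgue (\<Omega> - T) < \<epsilon> / 2 * m"
    using T(3,4) pos by (simp add: emeasure_eq_measure2 ennreal_less_iff)
  moreover have "emeasure M (\<Omega> - T) = ennreal (measure lebesgue (\<Omega> - T) / m)"
    using TM T(3) m by (subst emeasure_M) (auto simp: m_def sets_M_iff emeasure_eq_measure2 divide_ennreal)
  then have "prob (\<Omega> - T) = measure lebesgue (\<Omega> - T) / m"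
    using m by (simp add: emeasure_eq_measure)
  ultimately have 1: "prob (\<Omega> - T) < \<epsilon> / 2" using m by (simp only: pos_divide_less_eq)
  have "(\<lambda>n::nat. prob (T \<inter> cball 0 (real n))) \<longlonglongrightarrow> prob (\<Union>n::nat. T \<inter> cball 0 (real n))"
    using Tsets by (intro finite_Lim_measure_incseq) (auto simp: incseq_def)
  moreover have "(\<Union>n::nat. T \<inter> cball 0 (real n)) = T"
    by (auto simp: real_arch_simple)
  ultimately have "(\<lambda>n::nat. prob (T \<inter> cball 0 (real n))) \<longlonglongrightarrow> prob T" by simp
  then have "\<forall>\<^sub>F n::nat in sequentially. prob (T \<inter> cball 0 (real n)) > prob T - \<epsilon> / 2"
    by (rule order_tendstoD) (use assms in simp)
  then obtain n :: nat where n: "prob (T \<inter> cball 0 (real n)) > prob T - \<epsilon> / 2"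
    using eventually_happens'[OF sequentially_bot] by blast
  show thesis
  proof
    show "compact (T \<inter> cball 0 (real n))" using T by (simp add: closed_Int_compact)
    show "T \<inter> cball 0 (real n) \<subseteq> \<Omega>" using T by auto
    show "T \<inter> cball 0 (real n) \<in> sets M" by (rule Tsets)
    show "prob (\<Omega> - T \<inter> cball 0 (real n)) < \<epsilon>"
      using prob_compl[OF Tsets, of "real n"] prob_compl[OF TM] 1 n by simp
  qed
qed

text \<open>Membership in the mean-square closure of the trigonometric polynomials, measured by the
  squared distance to keep square roots away.\<close>

definition approximable :: "(real^'n \<Rightarrow> complex) \<Rightarrow> bool" where
  "approximable f \<longleftrightarrow> (\<forall>\<epsilon>>0. \<exists>p. trig p \<and> (\<integral>x. (cmod (f x - p x))\<^sup>2 \<partial>M) < \<epsilon>)"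

section \<open>Closure properties of approximability\<close>

lemma integral_add_sq_le:
  assumes "L2 f" "L2 g"
  shows "(\<integral>x. (cmod (f x + g x))\<^sup>2 \<partial>M) \<le> 2 * (\<integral>x. (cmod (f x))\<^sup>2 \<partial>M) + 2 * (\<integral>x. (cmod (g x))\<^sup>2 \<partial>M)"
proof -
  have "(\<integral>x. (cmod (f x + g x))\<^sup>2 \<partial>M) \<le> (\<integral>x. 2 * (cmod (f x))\<^sup>2 + 2 * (cmod (g x))\<^sup>2 \<partial>M)"
    using assms L2_add[OF assms] cmod_add_sq_le by (intro integral_mono) (auto simp: L2_def)
  then show ?thesis using assms by (simp add: L2_def)
qed

lemma approximable_limit:
  assumes f: "L2 f" and close: "\<And>\<epsilon>. \<epsilon> > 0 \<Longrightarrow> \<exists>g. L2 g \<and> approximable g \<and> (\<integral>x. (cmod (f x - g x))\<^sup>2 \<partial>M) < \<epsilon>"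
  shows "approximable f"
  unfolding approximable_def
proof (intro allI impI)
  fix \<epsilon> :: real assume "\<epsilon> > 0"
  \<comment> \<open>The quarter compensates for the factor 2 in |a + b|^2 \<le> 2 |a|^2 + 2 |b|^2,
    applied to two errors.\<close>
  then obtain g where g: "L2 g" "approximable g" "(\<integral>x. (cmod (f x - g x))\<^sup>2 \<partial>M) < \<epsilon> / 4"
    using close[of "\<epsilon> / 4"] by auto
  then obtain p where p: "trig p" "(\<integral>x. (cmod (g x - p x))\<^sup>2 \<partial>M) < \<epsilon> / 4"
    using \<open>\<epsilon> > 0\<close> unfolding approximable_def by (meson zero_less_divide_iff zero_less_numeral)
  have "(\<integral>x. (cmod ((f x - g x) + (g x - p x)))\<^sup>2 \<partial>M)
      \<le> 2 * (\<integral>x. (cmod (f x - g x))\<^sup>2 \<partial>M) + 2 * (\<integral>x. (cmod (g x - p x))\<^sup>2 \<partial>M)"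
    using f g L2_trig[OF p(1)] by (intro integral_add_sq_le L2_diff)
  with p g show "\<exists>p. trig p \<and> (\<integral>x. (cmod (f x - p x))\<^sup>2 \<partial>M) < \<epsilon>"
    by (intro exI[of _ p]) simp
qed

lemma approximable_add:
  assumes "L2 f" "L2 g" "approximable f" "approximable g"
  shows "approximable (\<lambda>x. f x + g x)"
  unfolding approximable_def
proof (intro allI impI)
  fix \<epsilon> :: real assume "\<epsilon> > 0"
  then obtain p q where p: "trig p" "(\<integral>x. (cmod (f x - p x))\<^sup>2 \<partial>M) < \<epsilon> / 4"
    and q: "trig q" "(\<integral>x. (cmod (g x - q x))\<^sup>2 \<partial>M) < \<epsilon> / 4"
    using assms unfolding approximable_def by (meson zero_less_divide_iff zero_less_numeral)
  have "(\<integral>x. (cmod ((f x - p x) + (g x - q x)))\<^sup>2 \<partial>M)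
      \<le> 2 * (\<integral>x. (cmod (f x - p x))\<^sup>2 \<partial>M) + 2 * (\<integral>x. (cmod (g x - q x))\<^sup>2 \<partial>M)"
    using assms L2_trig[OF p(1)] L2_trig[OF q(1)] by (intro integral_add_sq_le L2_diff)
  with p q show "\<exists>p. trig p \<and> (\<integral>x. (cmod (f x + g x - p x))\<^sup>2 \<partial>M) < \<epsilon>"
    by (intro exI[of _ "\<lambda>x. p x + q x"]) (simp add: trig_add add_diff_add)
qed

lemma approximable_ii_mult:
  assumes "approximable f" shows "approximable (\<lambda>x. \<i> * f x)"
  unfolding approximable_def
proof (intro allI impI)
  fix \<epsilon> :: real assume "\<epsilon> > 0"
  then obtain p where p: "trig p" "(\<integral>x. (cmod (f x - p x))\<^sup>2 \<partial>M) < \<epsilon>"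
    using assms unfolding approximable_def by blast
  have "cmod (\<i> * f x - \<i> * p x) = cmod (f x - p x)" for x
    by (simp add: norm_mult flip: right_diff_distrib)
  with p show "\<exists>p. trig p \<and> (\<integral>x. (cmod (\<i> * f x - p x))\<^sup>2 \<partial>M) < \<epsilon>"
    by (intro exI[of _ "\<lambda>x. \<i> * p x"]) (auto intro: trig_mult trig_const)
qed

text \<open>Dominated convergence turns pointwise into mean-square convergence. It serves both later
  passages: from continuous to bounded measurable functions, and from bounded to square integrable
  ones.\<close>

lemma approximable_dominated:
  assumes f: "L2 f" and g: "\<And>n::nat. L2 (g n)" "\<And>n. approximable (g n)"
    and lim: "AE x in M. (\<lambda>n. g n x) \<longlonglongrightarrow> f x"
    and W: "integrable M W" "\<And>n x. x \<in> \<Omega> \<Longrightarrow> (cmod (f x - g n x))\<^sup>2 \<le> W x"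
  shows "approximable f"
proof (rule approximable_limit[OF f])
  fix \<epsilon> :: real assume "\<epsilon> > 0"
  have [measurable]: "f \<in> borel_measurable M" "\<And>n. g n \<in> borel_measurable M" "W \<in> borel_measurable M"
    using f g W by (auto simp: L2_def)
  have "(\<lambda>n. \<integral>x. (cmod (f x - g n x))\<^sup>2 \<partial>M) \<longlonglongrightarrow> (\<integral>x. 0 \<partial>M)"
  proof (rule integral_dominated_convergence[where w = W])
    show "AE x in M. (\<lambda>n. (cmod (f x - g n x))\<^sup>2) \<longlonglongrightarrow> 0"
      using lim
    proof eventually_elim
      case (elim x)
      have "(\<lambda>n. (cmod (f x - g n x))\<^sup>2) \<longlonglongrightarrow> (cmod (f x - f x))\<^sup>2"
        by (intro tendsto_intros elim)
      then show ?case by simp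
    qed
  qed (use W in auto)
  then have "(\<lambda>n. \<integral>x. (cmod (f x - g n x))\<^sup>2 \<partial>M) \<longlonglongrightarrow> 0" by simp
  then have "\<forall>\<^sub>F n in sequentially. (\<integral>x. (cmod (f x - g n x))\<^sup>2 \<partial>M) < \<epsilon>"
    using \<open>\<epsilon> > 0\<close> by (rule order_tendstoD)
  then obtain n where "(\<integral>x. (cmod (f x - g n x))\<^sup>2 \<partial>M) < \<epsilon>"
    using eventually_happens'[OF sequentially_bot] by blast
  then show "\<exists>g. L2 g \<and> approximable g \<and> (\<integral>x. (cmod (f x - g x))\<^sup>2 \<partial>M) < \<epsilon>" using g by blast
qed

text \<open>Points of \<open>\<Omega>\<close> are pairwise inequivalent modulo \<open>L\<close>, so Stone-Weierstrass applies to trigonometric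
  polynomials on any compact \<open>K \<subseteq> \<Omega>\<close>; clamping controls the approximant on the small set \<open>\<Omega> - K\<close>.\<close>

lemma approximable_continuous:
  fixes g :: "real^'n \<Rightarrow> real"
  assumes cont: "continuous_on UNIV g" and B: "\<And>x. \<bar>g x\<bar> \<le> B"
  shows "approximable (\<lambda>x. complex_of_real (g x))"
  unfolding approximable_def
proof (intro allI impI)
  fix \<epsilon> :: real assume \<epsilon>: "\<epsilon> > 0"
  have B0: "B \<ge> 0" using B[of 0] by linarith
  \<comment> \<open>On K two errors of size \<delta> add up, so (2 \<delta>)^2 \<le> \<epsilon>/4 is
    wanted. Off K the bound \<delta> \<le> 1/2 keeps |g - p| below 2 B + 1; the measure of \<Omega>
    - K is then chosen so that this part costs at most \<epsilon>/2.\<close>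
  define \<delta> where "\<delta> = min (1/2) (sqrt \<epsilon> / 4)"
  have \<delta>: "\<delta> > 0" "\<delta> \<le> 1/2" and "\<delta>\<^sup>2 \<le> (sqrt \<epsilon> / 4)\<^sup>2"
    using \<epsilon> by (auto simp: \<delta>_def intro!: power_mono)
  then have \<delta>2: "(2 * \<delta>)\<^sup>2 \<le> \<epsilon> / 4" using \<epsilon> by (simp add: power_mult_distrib power_divide)
  obtain K where K: "compact K" "K \<subseteq> \<Omega>" "K \<in> sets M" "prob (\<Omega> - K) < \<epsilon> / (2 * (2 * B + 1)\<^sup>2)"
    using compact_exhaustion[of "\<epsilon> / (2 * (2 * B + 1)\<^sup>2)"] \<epsilon> B0 by auto
  have "\<exists>r. real_trig r \<and> (\<forall>x\<in>K. \<bar>g x - r x\<bar> < \<delta>)"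
  proof (rule Stone_Weierstrass_HOL[of K real_trig])
    show "continuous_on K g" using cont continuous_on_subset by blast
    show "\<exists>f. real_trig f \<and> f x \<noteq> f y" if "x \<in> K \<and> y \<in> K \<and> x \<noteq> y" for x y
      using that K real_trig_separates[of x y] by blast
  qed (use K \<delta> in \<open>auto intro: real_trig_const real_trig_add real_trig_mult continuous_on_real_trig\<close>)
  then obtain r where r: "real_trig r" "\<And>x. x \<in> K \<Longrightarrow> \<bar>g x - r x\<bar> < \<delta>" by blast
  obtain p where p: "real_trig p" "\<And>x. \<bar>max (- B) (min B (r x)) - p x\<bar> < \<delta>"
    using real_trig_clamp[OF r(1) \<delta>(1), of B] by blast
  have pt: "(g x - p x)\<^sup>2 \<le> (2 * \<delta>)\<^sup>2 + (2 * B + 1)\<^sup>2 * indicator (\<Omega> - K) x" if "x \<in> \<Omega>" for x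
  proof (cases "x \<in> K")
    case True
    \<comment> \<open>As |g| \<le> B, clamping r to [-B, B] does not increase its distance to
      g.\<close>
    have "\<bar>g x - p x\<bar> \<le> 2 * \<delta>" using r(2)[OF True] p(2)[of x] B[of x] by linarith
    then show ?thesis using True power_mono[of "\<bar>g x - p x\<bar>" "2 * \<delta>" 2] by simp
  next
    case False
    have "\<bar>g x - p x\<bar> \<le> 2 * B + 1" using p(2)[of x] B[of x] \<delta> by linarith
    then have "(g x - p x)\<^sup>2 \<le> (2 * B + 1)\<^sup>2" using power_mono[of "\<bar>g x - p x\<bar>" "2 * B + 1" 2] by simp
    then show ?thesis using False that by (simp add: add_increasing)
  qed
  have "L2 (\<lambda>x. complex_of_real (g x))"
    using cont B by (intro L2_bounded[of _ B] continuous_measurable_M continuous_intros) auto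
  then have "L2 (\<lambda>x. complex_of_real (g x - p x))"
    using L2_diff[OF _ L2_trig[OF p(1)[unfolded real_trig_def]], of "\<lambda>x. complex_of_real (g x)"] by simp
  then have int: "integrable M (\<lambda>x. (g x - p x)\<^sup>2)" by (simp add: L2_def del: of_real_diff)
  have sets: "\<Omega> - K \<in> sets M" using K sets.compl_sets[of K M] by simp
  have "(\<integral>x. (g x - p x)\<^sup>2 \<partial>M) \<le> (\<integral>x. (2 * \<delta>)\<^sup>2 + (2 * B + 1)\<^sup>2 * indicator (\<Omega> - K) x \<partial>M)"
    using int pt sets by (intro integral_mono) (auto simp: emeasure_eq_measure)
  also have "\<dots> = (2 * \<delta>)\<^sup>2 + (2 * B + 1)\<^sup>2 * prob (\<Omega> - K)"
  proof -
    have "(\<integral>x. (2 * \<delta>)\<^sup>2 \<partial>M) = (2 * \<delta>)\<^sup>2"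
      using prob_space by (simp only: lebesgue_integral_const) simp
    moreover have "(\<integral>x. (2 * B + 1)\<^sup>2 * indicator (\<Omega> - K) x \<partial>M) = (2 * B + 1)\<^sup>2 * prob ((\<Omega> - K) \<inter> space M)"
      unfolding integral_mult_right_zero by simp
    moreover have "(\<Omega> - K) \<inter> space M = \<Omega> - K" by auto
    ultimately show ?thesis
      using sets by (subst Bochner_Integration.integral_add) (simp_all add: emeasure_eq_measure del: Int_Diff)
  qed
  also have "\<dots> < \<epsilon>"
  proof -
    have "(2 * B + 1)\<^sup>2 * prob (\<Omega> - K) < (2 * B + 1)\<^sup>2 * (\<epsilon> / (2 * (2 * B + 1)\<^sup>2))"
      using K B0 by (intro mult_strict_left_mono) auto
    also have "\<dots> = \<epsilon> / 2" using B0 by simp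
    finally show ?thesis using \<delta>2 \<epsilon> by linarith
  qed
  finally have "(\<integral>x. (cmod (complex_of_real (g x) - complex_of_real (p x)))\<^sup>2 \<partial>M) < \<epsilon>"
    by (simp flip: of_real_diff)
  then show "\<exists>p. trig p \<and> (\<integral>x. (cmod (complex_of_real (g x) - p x))\<^sup>2 \<partial>M) < \<epsilon>"
    using p(1) unfolding real_trig_def by (intro exI[of _ "\<lambda>x. complex_of_real (p x)"]) blast
qed

text \<open>A Lebesgue measurable function is almost everywhere a limit of continuous functions on
  the whole space. Clamping these to [-B, B] provides a constant dominating function and does not
  disturb the limit, whose values lie in that interval.\<close>

lemma approximable_bounded:
  fixes f :: "real^'n \<Rightarrow> real"
  assumes f [measurable]: "f \<in> borel_measurable M" and B: "\<And>x. x \<in> \<Omega> \<Longrightarrow> \<bar>f x\<bar> \<le> B" and "B \<ge> 0"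
  shows "approximable (\<lambda>x. complex_of_real (f x))"
proof -
  have "f \<in> borel_measurable (lebesgue_on \<Omega>)" using f by (simp add: measurable_cong_sets[OF sets_M refl])
  then have "f measurable_on \<Omega>" using sets_Omega by (simp add: measurable_on_iff_borel_measurable)
  then obtain N g where N: "negligible N" and g: "\<And>n. continuous_on UNIV (g n)"
    and lim: "\<And>x. x \<notin> N \<Longrightarrow> (\<lambda>n. g n x) \<longlonglongrightarrow> (if x \<in> \<Omega> then f x else 0)"
    unfolding measurable_on_def by blast
  define h where "h n x = max (- B) (min B (g n x))" for n x
  have h: "\<bar>h n x\<bar> \<le> B" "continuous_on UNIV (h n)" for n x
    using g \<open>B \<ge> 0\<close> by (auto simp: h_def[abs_def] intro!: continuous_intros)
  have N\<Omega>: "N \<inter> \<Omega> \<in> sets M" "emeasure M (N \<inter> \<Omega>) = 0"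
  proof -
    have "N \<inter> \<Omega> \<in> null_sets lebesgue"
      using N by (simp add: negligible_Int flip: negligible_iff_null_sets)
    then show "N \<inter> \<Omega> \<in> sets M" by (auto simp: sets_M_iff)
    then show "emeasure M (N \<inter> \<Omega>) = 0"
      using \<open>N \<inter> \<Omega> \<in> null_sets lebesgue\<close> by (subst emeasure_M) auto
  qed
  show ?thesis
  proof (rule approximable_dominated[where g = "\<lambda>n x. complex_of_real (h n x)" and W = "\<lambda>_. (2 * B)\<^sup>2"])
    show "L2 (\<lambda>x. complex_of_real (f x))" by (rule L2_bounded[where B = B]) (use B in auto)
    show "L2 (\<lambda>x. complex_of_real (h n x))" for n
      using h by (intro L2_bounded[where B = B] continuous_measurable_M continuous_intros) auto
    show "approximable (\<lambda>x. complex_of_real (h n x))" for n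
      using h by (intro approximable_continuous)
    show "AE x in M. (\<lambda>n. complex_of_real (h n x)) \<longlonglongrightarrow> complex_of_real (f x)"
    proof (rule AE_I[OF _ N\<Omega>(2,1)], rule subsetI)
      fix x assume x: "x \<in> {x \<in> space M. \<not> (\<lambda>n. complex_of_real (h n x)) \<longlonglongrightarrow> complex_of_real (f x)}"
      show "x \<in> N \<inter> \<Omega>"
      proof (rule ccontr)
        assume "x \<notin> N \<inter> \<Omega>"
        with x have "x \<in> \<Omega>" "x \<notin> N" by auto
        then have "(\<lambda>n. g n x) \<longlonglongrightarrow> f x" using lim[of x] by simp
        then have "(\<lambda>n. h n x) \<longlonglongrightarrow> max (- B) (min B (f x))"
          unfolding h_def by (intro tendsto_intros)
        also have "max (- B) (min B (f x)) = f x" using B[OF \<open>x \<in> \<Omega>\<close>] by auto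
        finally have "(\<lambda>n. complex_of_real (h n x)) \<longlonglongrightarrow> complex_of_real (f x)" by (intro tendsto_intros)
        then show False using x by blast
      qed
    qed
    show "(cmod (complex_of_real (f x) - complex_of_real (h n x)))\<^sup>2 \<le> (2 * B)\<^sup>2" if "x \<in> \<Omega>" for n x
    proof -
      have "\<bar>f x - h n x\<bar> \<le> 2 * B" using B[OF that] h(1)[of n x] by linarith
      then show ?thesis using power_mono[of "\<bar>f x - h n x\<bar>" "2 * B" 2] by (simp flip: of_real_diff)
    qed
  qed simp
qed

text \<open>The truncations at height n agree with f from some n on at each point, and the error
  never exceeds |f|, whose square is integrable.\<close>

lemma approximable_real:
  fixes f :: "real^'n \<Rightarrow> real"
  assumes f: "f \<in> borel_measurable M" "integrable M (\<lambda>x. (f x)\<^sup>2)"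
  shows "approximable (\<lambda>x. complex_of_real (f x))"
proof -
  define h where "h n x = max (- real n) (min (real n) (f x))" for n x
  have [measurable]: "f \<in> borel_measurable M" "\<And>n. h n \<in> borel_measurable M"
    using f(1) by (auto simp: h_def[abs_def])
  have h: "\<bar>h n x\<bar> \<le> real n" for n x by (auto simp: h_def)
  show ?thesis
  proof (rule approximable_dominated[where g = "\<lambda>n x. complex_of_real (h n x)" and W = "\<lambda>x. (f x)\<^sup>2"])
    show "L2 (\<lambda>x. complex_of_real (f x))" using f by (simp add: L2_def)
    show "L2 (\<lambda>x. complex_of_real (h n x))" for n
      using h by (intro L2_bounded[where B = "real n"]) auto
    show "approximable (\<lambda>x. complex_of_real (h n x))" for n
      using h by (intro approximable_bounded[where B = "real n"]) auto
    show "AE x in M. (\<lambda>n. complex_of_real (h n x)) \<longlonglongrightarrow> complex_of_real (f x)"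
    proof (rule AE_I2)
      fix x
      have "\<forall>\<^sub>F n in sequentially. h n x = f x"
        using eventually_ge_at_top[of "nat \<lceil>\<bar>f x\<bar>\<rceil>"]
        by eventually_elim (auto simp: h_def max_def min_def abs_le_iff nat_ceiling_le_eq)
      then show "(\<lambda>n. complex_of_real (h n x)) \<longlonglongrightarrow> complex_of_real (f x)"
        by (intro tendsto_of_real tendsto_eventually)
    qed
    show "(cmod (complex_of_real (f x) - complex_of_real (h n x)))\<^sup>2 \<le> (f x)\<^sup>2" for n x
    proof -
      have "\<bar>f x - h n x\<bar> \<le> \<bar>f x\<bar>" by (auto simp: h_def max_def min_def abs_if)
      then show ?thesis using power_mono[of "\<bar>f x - h n x\<bar>" "\<bar>f x\<bar>" 2] by (simp flip: of_real_diff)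
    qed
  qed (use f in simp)
qed

lemma approximable_L2:
  assumes "L2 f" shows "approximable f"
proof -
  have [measurable]: "f \<in> borel_measurable M" using assms by (simp add: L2_def)
  have bd: "(Re z)\<^sup>2 \<le> (cmod z)\<^sup>2" "(Im z)\<^sup>2 \<le> (cmod z)\<^sup>2" for z by (auto simp: cmod_power2)
  have int: "integrable M (\<lambda>x. (Re (f x))\<^sup>2)" "integrable M (\<lambda>x. (Im (f x))\<^sup>2)"
    using assms bd unfolding L2_def
    by (auto intro!: Bochner_Integration.integrable_bound[of M "\<lambda>x. (cmod (f x))\<^sup>2"])
  have "approximable (\<lambda>x. complex_of_real (Re (f x)) + \<i> * complex_of_real (Im (f x)))"
  proof (intro approximable_add approximable_ii_mult approximable_real L2_cmult)
    show "L2 (\<lambda>x. complex_of_real (Re (f x)))" "L2 (\<lambda>x. complex_of_real (Im (f x)))"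
      using int by (simp_all add: L2_def)
  qed (use int in simp_all)
  then show ?thesis by (simp flip: complex_eq)
qed

lemma trig_dense:
  assumes "L2 f" "\<epsilon> > 0"
  shows "\<exists>S c. finite S \<and> S \<subseteq> D \<and> (\<integral>x. (cmod (f x - (\<Sum>\<kappa>\<in>S. c \<kappa> * lattice_char \<kappa> x)))\<^sup>2 \<partial>M) < \<epsilon>"
proof -
  obtain p where p: "trig p" "(\<integral>x. (cmod (f x - p x))\<^sup>2 \<partial>M) < \<epsilon>"
    using approximable_L2[OF assms(1)] assms(2) unfolding approximable_def by blast
  then show ?thesis using trig_eq_sum[OF p(1)] by blast
qed

section \<open>Modulus of continuity and Fourier tails\<close>

definition modulus_sq :: "(real^'n \<Rightarrow> complex) \<Rightarrow> real^'n \<Rightarrow> real" where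
  "modulus_sq f h = (\<integral>x. (cmod (f (shift h x) - f x))\<^sup>2 \<partial>M)"

lemma modulus_sq_nonneg: "modulus_sq f h \<ge> 0"
  by (simp add: modulus_sq_def)

lemma sum_le_modulus_sq:
  assumes "L2 f" "finite F" "F \<subseteq> D"
  shows "(\<Sum>\<kappa>\<in>F. (cmod (lattice_char \<kappa> h - 1))\<^sup>2 * (cmod (coeff f \<kappa>))\<^sup>2) \<le> modulus_sq f h"
proof -
  have "(\<Sum>\<kappa>\<in>F. (cmod (lattice_char \<kappa> h - 1))\<^sup>2 * (cmod (coeff f \<kappa>))\<^sup>2)
      = (\<Sum>\<kappa>\<in>F. (cmod (coeff (\<lambda>x. f (shift h x) - f x) \<kappa>))\<^sup>2)"
    using assms by (intro sum.cong) (auto simp: coeff_difference norm_mult power_mult_distrib)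
  also have "\<dots> \<le> modulus_sq f h"
    unfolding modulus_sq_def using assms by (intro bessel L2_diff L2_shift)
  finally show ?thesis .
qed

text \<open>The difference f(x + h) - f(x) is itself square integrable, so density of trigonometric
  polynomials is applied directly to it.\<close>

lemma modulus_sq_le:
  assumes f: "L2 f"
    and B: "\<And>F. finite F \<Longrightarrow> F \<subseteq> D \<Longrightarrow> (\<Sum>\<kappa>\<in>F. (cmod (lattice_char \<kappa> h - 1))\<^sup>2 * (cmod (coeff f \<kappa>))\<^sup>2) \<le> B"
  shows "modulus_sq f h \<le> B"
  unfolding modulus_sq_def
proof (rule norm_sq_le_of_partial_sums)
  show L: "L2 (\<lambda>x. f (shift h x) - f x)" using f by (intro L2_diff L2_shift)
  show "\<exists>S c. finite S \<and> S \<subseteq> D \<and>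
      (\<integral>x. (cmod (f (shift h x) - f x - (\<Sum>k\<in>S. c k * lattice_char k x)))\<^sup>2 \<partial>M) < \<epsilon>" if "\<epsilon> > 0" for \<epsilon>
    using trig_dense[OF L that] .
  show "(\<Sum>k\<in>S. (cmod (coeff (\<lambda>x. f (shift h x) - f x) k))\<^sup>2) \<le> B" if S: "finite S" "S \<subseteq> D" for S
  proof -
    have "(\<Sum>k\<in>S. (cmod (coeff (\<lambda>x. f (shift h x) - f x) k))\<^sup>2)
        = (\<Sum>k\<in>S. (cmod (lattice_char k h - 1))\<^sup>2 * (cmod (coeff f k))\<^sup>2)"
      using S f by (intro sum.cong) (auto simp: coeff_difference norm_mult power_mult_distrib)
    then show ?thesis using B[OF S] by simp
  qed
qed

lemma L2_iff_Lp_space: "f \<in> Lp_space M 2 \<longleftrightarrow> L2 f"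
  by (simp add: Lp_space_def L2_def powr_numeral)

lemma Lip_iff:
  assumes "L2 f"
  shows "f \<in> Lip L \<Omega> \<alpha> 2 \<longleftrightarrow> (\<lambda>h. sqrt (modulus_sq f h)) \<in> O[at 0](\<lambda>h. norm h powr \<alpha>)"
proof -
  have "Lp_norm M 2 (\<lambda>x. periodic_ext L \<Omega> f (x + h) - periodic_ext L \<Omega> f x) = sqrt (modulus_sq f h)" for h
  proof -
    have "(\<integral>x. (cmod (periodic_ext L \<Omega> f (x + h) - periodic_ext L \<Omega> f x))\<^sup>2 \<partial>M) = modulus_sq f h"
      unfolding modulus_sq_def
    proof (intro Bochner_Integration.integral_cong refl)
      fix x assume "x \<in> space M"
      \<comment> \<open>Points of \<Omega> represent themselves because 0 lies in L.\<close>
      then have "rep x = x" by (intro rep_eqI) (auto simp: lattice_of_zero)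
      then show "(cmod (periodic_ext L \<Omega> f (x + h) - periodic_ext L \<Omega> f x))\<^sup>2 = (cmod (f (shift h x) - f x))\<^sup>2"
        by (simp add: periodic_ext_eq shift_def)
    qed
    then show ?thesis using modulus_sq_nonneg[of f h] by (simp add: Lp_norm_def powr_numeral powr_half_sqrt)
  qed
  then show ?thesis using assms by (simp add: Lip_def L2_iff_Lp_space)
qed

text \<open>An infinite sum of a non-summable family has the default value 0, so the bounds on tails
  carry information only together with this consequence of Bessel.\<close>

lemma summable_coeff:
  assumes "L2 f" shows "(\<lambda>\<kappa>. (cmod (coeff f \<kappa>))\<^sup>2) summable_on D"
  using bessel[OF _ _ assms]
  by (intro nonneg_bdd_above_summable_on bdd_aboveI2[where M = "\<integral>x. (cmod (f x))\<^sup>2 \<partial>M"]) auto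

definition tail :: "(real^'n \<Rightarrow> complex) \<Rightarrow> real \<Rightarrow> real" where
  "tail f N = (\<Sum>\<^sub>\<infinity>\<kappa>\<in>{\<kappa> \<in> D. norm \<kappa> > N}. (cmod (coeff f \<kappa>))\<^sup>2)"

lemma tail_nonneg: "tail f N \<ge> 0"
  unfolding tail_def by (intro infsum_nonneg) auto

lemma sum_le_tail:
  assumes "L2 f" "finite F" "F \<subseteq> D"
  shows "(\<Sum>\<kappa>\<in>{\<kappa> \<in> F. N < norm \<kappa>}. (cmod (coeff f \<kappa>))\<^sup>2) \<le> tail f N"
  unfolding tail_def using assms summable_on_subset_banach[OF summable_coeff[OF assms(1)]]
  by (intro finite_sum_le_infsum) auto

lemma tail_le:
  assumes "L2 f" and "\<And>F. finite F \<Longrightarrow> F \<subseteq> D \<Longrightarrow> (\<Sum>\<kappa>\<in>{\<kappa> \<in> F. N < norm \<kappa>}. (cmod (coeff f \<kappa>))\<^sup>2) \<le> B"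
  shows "tail f N \<le> B"
  unfolding tail_def
proof (rule infsum_le_finite_sums)
  show "(\<lambda>\<kappa>. (cmod (coeff f \<kappa>))\<^sup>2) summable_on {\<kappa> \<in> D. norm \<kappa> > N}"
    by (rule summable_on_subset_banach[OF summable_coeff[OF assms(1)]]) auto
  fix F assume F: "finite F" "F \<subseteq> {\<kappa> \<in> D. norm \<kappa> > N}"
  then have "{\<kappa> \<in> F. N < norm \<kappa>} = F" "F \<subseteq> D" by auto
  then show "(\<Sum>\<kappa>\<in>F. (cmod (coeff f \<kappa>))\<^sup>2) \<le> B" using assms(2)[OF F(1)] by simp
qed

text \<open>For a frequency of size between \<open>N\<close> and \<open>2N\<close>, one of the \<open>n\<close> coordinate shifts by \<open>1/(4N)\<close>
  changes the phase by a definite amount; this replaces the usual averaging over all shifts.\<close>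

lemma block_le_modulus_sq:
  fixes f N
  defines "s \<equiv> sin (pi / (4 * real CARD('n)))"
  assumes f: "L2 f" and F: "finite F" "F \<subseteq> D" and N: "N > 0"
  shows "4 * s\<^sup>2 * (\<Sum>\<kappa>\<in>{\<kappa> \<in> F. N < norm \<kappa> \<and> norm \<kappa> \<le> 2 * N}. (cmod (coeff f \<kappa>))\<^sup>2)
    \<le> (\<Sum>j\<in>UNIV. modulus_sq f (axis j (1 / (4 * N))))"
proof -
  define d where "d = real CARD('n)"
  have d: "d \<ge> 1" by (simp add: d_def Suc_leI)
  have d4: "pi / (4 * d) \<ge> 0" "pi / (4 * d) \<le> pi / 2" using d by (auto simp: field_simps)
  have s0: "s \<ge> 0" using d4 unfolding s_def d_def[symmetric] by (intro sin_ge_zero) auto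
  define G where "G = {\<kappa> \<in> F. N < norm \<kappa> \<and> norm \<kappa> \<le> 2 * N}"
  have G: "finite G" "G \<subseteq> D" using F by (auto simp: G_def)
  have osc: "4 * s\<^sup>2 \<le> (\<Sum>j\<in>UNIV. (cmod (lattice_char \<kappa> (axis j (1 / (4 * N))) - 1))\<^sup>2)" if "\<kappa> \<in> G" for \<kappa>
  proof -
    have \<kappa>: "N < norm \<kappa>" "norm \<kappa> \<le> 2 * N" using that by (auto simp: G_def)
    \<comment> \<open>The Euclidean norm is at most the sum of the d absolute coordinates, so they
      cannot all lie below |\<kappa>|/d.\<close>
    have "\<exists>j. \<bar>\<kappa> $ j\<bar> \<ge> norm \<kappa> / d"
    proof (rule ccontr)
      assume "\<not> ?thesis"
      then have "(\<Sum>j\<in>UNIV. \<bar>\<kappa> $ j\<bar>) < (\<Sum>j\<in>(UNIV :: 'n set). norm \<kappa> / d)"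
        by (intro sum_strict_mono) (auto simp: not_le)
      also have "\<dots> = norm \<kappa>" using d by (simp add: d_def)
      finally show False using norm_le_l1_cart[of \<kappa>] by simp
    qed
    then obtain j where j: "\<bar>\<kappa> $ j\<bar> \<ge> norm \<kappa> / d" by blast
    \<comment> \<open>Half the phase that the shift along axis j produces, up to sign. The shift
      length 1/(4N) makes t at most \<pi>/2 for |\<kappa>| \<le> 2N, so the sine is still
      increasing, while |\<kappa>| > N keeps t at least \<pi>/(4d); this is where s comes
      from.\<close>
    define t where "t = pi * (\<bar>\<kappa> $ j\<bar> / (4 * N))"
    have "N / d \<le> \<bar>\<kappa> $ j\<bar>" using j \<kappa> d by (meson divide_right_mono less_imp_le order_trans zero_le_one)
    then have "1 / (4 * d) \<le> \<bar>\<kappa> $ j\<bar> / (4 * N)" using N d by (simp add: field_simps)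
    then have "pi * (1 / (4 * d)) \<le> t" unfolding t_def by (intro mult_left_mono) auto
    then have t1: "pi / (4 * d) \<le> t" by simp
    have "\<bar>\<kappa> $ j\<bar> / (4 * N) \<le> 1 / 2"
      using component_le_norm_cart[of \<kappa> j] \<kappa> N by (simp add: field_simps)
    then have "t \<le> pi * (1 / 2)" unfolding t_def by (intro mult_left_mono) auto
    then have t2: "t \<le> pi / 2" by simp
    have "s \<le> sin t"
      unfolding s_def d_def[symmetric] using t1 t2 d4 by (intro sin_monotone_2pi_le) auto
    moreover have "\<bar>sin (pi * (\<kappa> \<bullet> axis j (1 / (4 * N))))\<bar> = \<bar>sin t\<bar>"
      using N by (cases "\<kappa> $ j \<ge> 0") (auto simp: t_def inner_axis)
    ultimately have "2 * s \<le> cmod (lattice_char \<kappa> (axis j (1 / (4 * N))) - 1)"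
      unfolding norm_lattice_char_minus_1 by simp
    then have "(2 * s)\<^sup>2 \<le> (cmod (lattice_char \<kappa> (axis j (1 / (4 * N))) - 1))\<^sup>2"
      using s0 by (intro power_mono) auto
    also have "\<dots> \<le> (\<Sum>j\<in>UNIV. (cmod (lattice_char \<kappa> (axis j (1 / (4 * N))) - 1))\<^sup>2)"
      by (intro member_le_sum) auto
    finally show ?thesis by (simp add: power_mult_distrib)
  qed
  have "4 * s\<^sup>2 * (\<Sum>\<kappa>\<in>G. (cmod (coeff f \<kappa>))\<^sup>2)
      \<le> (\<Sum>\<kappa>\<in>G. (\<Sum>j\<in>UNIV. (cmod (lattice_char \<kappa> (axis j (1 / (4 * N))) - 1))\<^sup>2) * (cmod (coeff f \<kappa>))\<^sup>2)"
    unfolding sum_distrib_left using osc by (intro sum_mono mult_right_mono) auto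
  also have "\<dots> = (\<Sum>j\<in>UNIV. \<Sum>\<kappa>\<in>G. (cmod (lattice_char \<kappa> (axis j (1 / (4 * N))) - 1))\<^sup>2 * (cmod (coeff f \<kappa>))\<^sup>2)"
    unfolding sum_distrib_right by (rule sum.swap)
  also have "\<dots> \<le> (\<Sum>j\<in>UNIV. modulus_sq f (axis j (1 / (4 * N))))"
    by (intro sum_mono sum_le_modulus_sq f G)
  finally show ?thesis by (simp add: G_def)
qed

section \<open>The two implications\<close>

lemma tail_bigo_of_modulus:
  assumes f: "L2 f" and \<alpha>: "0 < \<alpha>"
    and O: "(\<lambda>h. sqrt (modulus_sq f h)) \<in> O[at 0](\<lambda>h. norm h powr \<alpha>)"
  shows "(\<lambda>N::nat. tail f (real N)) \<in> O(\<lambda>N. real N powr (- 2 * \<alpha>))"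
proof -
  obtain c where c: "c > 0" "\<forall>\<^sub>F h in at 0. norm (sqrt (modulus_sq f h)) \<le> c * norm (norm h powr \<alpha>)"
    using O by (elim landau_o.bigE)
  then obtain \<delta> where \<delta>: "\<delta> > 0"
    and le: "\<And>h. h \<noteq> 0 \<Longrightarrow> norm h < \<delta> \<Longrightarrow> sqrt (modulus_sq f h) \<le> c * norm h powr \<alpha>"
    unfolding eventually_at using modulus_sq_nonneg by (auto simp: dist_norm)
  define s where "s = sin (pi / (4 * real CARD('n)))"
  define d where "d = real CARD('n)"
  have d: "d \<ge> 1" by (simp add: d_def Suc_leI)
  then have s: "s > 0" unfolding s_def d_def[symmetric] by (intro sin_gt_zero) (auto simp: field_simps)
  \<comment> \<open>Each coordinate shift contributes at most c^2 N^(-2 \<alpha>), and the sum over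
    all of them is divided by the oscillation bound 4 s^2.\<close>
  define C where "C = real CARD('n) * c\<^sup>2 / (4 * s\<^sup>2)"
  \<comment> \<open>The successor makes N0 exceed 1/\<delta> strictly, so that all shifts used have
    length below \<delta>, and keeps N0 positive.\<close>
  define N0 where "N0 = Suc (nat \<lceil>1 / \<delta>\<rceil>)"
  have blocks: "(\<Sum>\<kappa>\<in>{\<kappa> \<in> F. real N < norm \<kappa> \<and> norm \<kappa> \<le> 2 * real N}. (cmod (coeff f \<kappa>))\<^sup>2) \<le> C * real N powr - (2 * \<alpha>)"
    if F: "finite F" "F \<subseteq> D" and N: "N0 \<le> N" for F N
  proof -
    have N0: "real N > 0" using N by (simp add: N0_def)
    have "1 / \<delta> < real N" using N unfolding N0_def by linarith
    then have small: "1 / (4 * real N) < \<delta>" using \<delta> N0 by (simp add: field_simps)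
    have "modulus_sq f (axis j (1 / (4 * real N))) \<le> c\<^sup>2 * real N powr - (2 * \<alpha>)" for j
    proof -
      let ?h = "axis j (1 / (4 * real N)) :: real^'n"
      have "norm ?h = sqrt ((1 / (4 * real N)) * (1 / (4 * real N)))"
        unfolding norm_eq_sqrt_inner inner_axis_axis by simp
      then have "norm ?h = 1 / (4 * real N)" unfolding real_sqrt_abs2 by simp
      then have "sqrt (modulus_sq f ?h) \<le> c * (1 / (4 * real N)) powr \<alpha>"
        using le[of ?h] small N0 by (simp add: axis_eq_0_iff)
      \<comment> \<open>The factor 4^(-\<alpha>) \<le> 1 is simply discarded.\<close>
      also have "\<dots> \<le> c * (1 / real N) powr \<alpha>"
        using c N0 \<alpha> by (intro mult_left_mono powr_mono2) (auto simp: field_simps)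
      finally have "(sqrt (modulus_sq f ?h))\<^sup>2 \<le> (c * (1 / real N) powr \<alpha>)\<^sup>2"
        using modulus_sq_nonneg by (intro power_mono) auto
      also have "\<dots> = c\<^sup>2 * real N powr - (2 * \<alpha>)"
        using N0 by (simp add: power_mult_distrib powr_divide powr_minus powr_power field_simps)
      finally show ?thesis using modulus_sq_nonneg by simp
    qed
    then have "(\<Sum>j\<in>UNIV. modulus_sq f (axis j (1 / (4 * real N)))) \<le> real CARD('n) * (c\<^sup>2 * real N powr - (2 * \<alpha>))"
      by (intro sum_bounded_above[where A = UNIV, simplified])
    with block_le_modulus_sq[OF f F N0]
    have "4 * s\<^sup>2 * (\<Sum>\<kappa>\<in>{\<kappa> \<in> F. real N < norm \<kappa> \<and> norm \<kappa> \<le> 2 * real N}. (cmod (coeff f \<kappa>))\<^sup>2)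
        \<le> real CARD('n) * (c\<^sup>2 * real N powr - (2 * \<alpha>))" unfolding s_def by linarith
    then show ?thesis using s by (simp add: C_def field_simps)
  qed
  have "tail f (real N) \<le> C / (1 - 2 powr - (2 * \<alpha>)) * real N powr - (2 * \<alpha>)" if "N0 \<le> N" for N
  proof (rule tail_le[OF f])
    fix F assume "finite F" "F \<subseteq> D"
    then show "(\<Sum>\<kappa>\<in>{\<kappa> \<in> F. real N < norm \<kappa>}. (cmod (coeff f \<kappa>))\<^sup>2)
        \<le> C / (1 - 2 powr - (2 * \<alpha>)) * real N powr - (2 * \<alpha>)"
      using \<alpha> that blocks by (intro sum_tail_le_of_dyadic_blocks[where ?N0.0 = N0]) (auto simp: C_def N0_def)
  qed
  then have "\<forall>\<^sub>F N in sequentially. norm (tail f (real N)) \<le> C / (1 - 2 powr - (2 * \<alpha>)) * norm (real N powr (- 2 * \<alpha>))"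
    unfolding eventually_sequentially using tail_nonneg by (intro exI[of _ N0]) simp
  then show ?thesis by (rule bigoI)
qed

lemma modulus_bigo_of_tail:
  assumes f: "L2 f" and \<alpha>: "0 < \<alpha>" "\<alpha> < 1"
    and O: "(\<lambda>N::nat. tail f (real N)) \<in> O(\<lambda>N. real N powr (- 2 * \<alpha>))"
  shows "(\<lambda>h. sqrt (modulus_sq f h)) \<in> O[at 0](\<lambda>h. norm h powr \<alpha>)"
proof -
  let ?a = "\<lambda>\<kappa>. (cmod (coeff f \<kappa>))\<^sup>2"
  obtain C0 where C0: "C0 > 0" "\<forall>\<^sub>F N::nat in sequentially. norm (tail f (real N)) \<le> C0 * norm (real N powr (- 2 * \<alpha>))"
    using O by (elim landau_o.bigE)
  then obtain N1 where N1: "\<And>N. N1 \<le> N \<Longrightarrow> tail f (real N) \<le> C0 * real N powr - (2 * \<alpha>)"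
    using tail_nonneg unfolding eventually_sequentially by auto
  define N0 where "N0 = Suc N1"
  define S where "S = infsum ?a D"
  have sumS: "sum ?a F \<le> S" if "finite F" "F \<subseteq> D" for F
    unfolding S_def using that summable_coeff[OF f] by (intro finite_sum_le_infsum) auto
  have S0: "S \<ge> 0" using sumS[of "{}"] by simp
  \<comment> \<open>The tail hypothesis speaks of large N only, but the dyadic lemma needs every n.
    For 2^n < N0 the total mass S serves as the bound, and S N0^(2 \<alpha>) (2^n)^(-2 \<alpha>)
    \<ge> S then holds.\<close>
  define C where "C = C0 + S * real N0 powr (2 * \<alpha>)"
  have C: "C \<ge> 0" using C0 S0 by (simp add: C_def)
  have pow: "(4 powr - \<alpha>) ^ n = real (2 ^ n) powr - (2 * \<alpha>)" for n
  proof -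
    have "(4::real) powr - \<alpha> = 2 powr - (2 * \<alpha>)" using powr_powr[of 2 2 "- \<alpha>"] by simp
    then show ?thesis by (simp add: powr_power powr_realpow[symmetric] powr_powr mult_ac)
  qed
  have tails: "(\<Sum>\<kappa>\<in>{\<kappa> \<in> F. 2 ^ n < norm \<kappa>}. ?a \<kappa>) \<le> C * (4 powr - \<alpha>) ^ n"
    if F: "finite F" "F \<subseteq> D" for F n
  proof (cases "N0 \<le> 2 ^ n")
    case True
    have "(\<Sum>\<kappa>\<in>{\<kappa> \<in> F. 2 ^ n < norm \<kappa>}. ?a \<kappa>) \<le> tail f (real (2 ^ n))"
      using sum_le_tail[OF f F, of "2 ^ n"] by simp
    also have "\<dots> \<le> C0 * (4 powr - \<alpha>) ^ n" unfolding pow using True by (intro N1) (simp add: N0_def)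
    also have "\<dots> \<le> C * (4 powr - \<alpha>) ^ n" using S0 by (intro mult_right_mono) (auto simp: C_def)
    finally show ?thesis .
  next
    case False
    have "sum ?a {\<kappa> \<in> F. 2 ^ n < norm \<kappa>} \<le> S * 1" using F sumS[of "{\<kappa> \<in> F. 2 ^ n < norm \<kappa>}"] by auto
    also have "1 = real N0 powr (2 * \<alpha>) * real N0 powr - (2 * \<alpha>)"
      by (simp add: N0_def flip: powr_add)
    also have "S * \<dots> \<le> S * (real N0 powr (2 * \<alpha>) * real (2 ^ n) powr - (2 * \<alpha>))"
      using False S0 \<alpha> by (intro mult_left_mono powr_mono2') (auto simp: N0_def simp flip: of_nat_power)
    also have "\<dots> \<le> C * (4 powr - \<alpha>) ^ n"
      unfolding pow mult.assoc[symmetric] using C0 by (intro mult_right_mono) (auto simp: C_def)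
    finally show ?thesis .
  qed
  define K where "K = S + 4 * C / (4 powr (1 - \<alpha>) - 1)"
  have "4 powr (1 - \<alpha>) > (1::real)" using \<alpha> by simp
  then have K: "K \<ge> 0" using S0 C by (simp add: K_def)
  \<comment> \<open>The first term collects the low frequencies, the second the high ones; the
    factor 4^\<alpha> is the price of rounding 1/|h| to a power of 2.\<close>
  define B where "B = 4 * pi\<^sup>2 * K + 4 * C * 4 powr \<alpha>"
  have B: "B \<ge> 0" using K C by (simp add: B_def)
  have main: "modulus_sq f h \<le> B * norm h powr (2 * \<alpha>)" if h: "h \<noteq> 0" "norm h < 1" for h
  proof -
    define r where "r = norm h"
    have r: "0 < r" "r < 1" using h by (auto simp: r_def)
    obtain m0 :: nat where "1 / r < 2 ^ m0" using real_arch_pow[of 2 "1 / r"] by auto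
    \<comment> \<open>With n = m - 1 this yields 2^n \<le> 1/r < 2^(n+1). The predecessor exists
      because r < 1 rules out m = 0.\<close>
    define m where "m = (LEAST m. 1 / r < 2 ^ m)"
    have m: "1 / r < 2 ^ m" unfolding m_def by (rule LeastI) fact
    have "m \<noteq> 0" using m r by (intro notI) (simp add: field_simps)
    then obtain n where n: "m = Suc n" by (cases m) auto
    have "\<not> 1 / r < 2 ^ n" using not_less_Least[of n "\<lambda>m. 1 / r < 2 ^ m"] n by (simp add: m_def)
    then have n1: "2 ^ n \<le> 1 / r" by simp
    have n2: "1 / r < 2 * 2 ^ n" using m n by simp
    have q1: "(4 powr (1 - \<alpha>)) ^ n \<le> r powr (2 * \<alpha> - 2)"
    proof -
      have "(4::real) powr (1 - \<alpha>) = 2 powr (2 * (1 - \<alpha>))" using powr_powr[of 2 2 "1 - \<alpha>"] by simp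
      then have "(4 powr (1 - \<alpha>)) ^ n = (2 ^ n) powr (2 * (1 - \<alpha>))"
        by (simp add: powr_power powr_realpow[symmetric] powr_powr mult_ac)
      also have "\<dots> \<le> (1 / r) powr (2 * (1 - \<alpha>))" using n1 \<alpha> by (intro powr_mono2) auto
      also have "\<dots> = r powr - (2 * (1 - \<alpha>))"
        using r by (subst powr_minus_divide, subst powr_divide) auto
      also have "- (2 * (1 - \<alpha>)) = 2 * \<alpha> - 2" by simp
      finally show ?thesis .
    qed
    have q2: "(4 powr - \<alpha>) ^ n \<le> 4 powr \<alpha> * r powr (2 * \<alpha>)"
    proof -
      \<comment> \<open>The exponent is negative, so here the lower bound 2^n > 1/(2r) matters,
        whereas the low frequencies used 2^n \<le> 1/r.\<close>
      have "real (2 ^ n) powr - (2 * \<alpha>) \<le> (1 / (2 * r)) powr - (2 * \<alpha>)"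
        using n2 r \<alpha> by (intro powr_mono2') (auto simp: field_simps)
      also have "\<dots> = (2 * r) powr (2 * \<alpha>)" using r by (simp add: powr_divide powr_minus_divide)
      also have "\<dots> = 4 powr \<alpha> * r powr (2 * \<alpha>)"
        using r powr_powr[of 2 2 \<alpha>] by (simp add: powr_mult)
      finally show ?thesis unfolding pow .
    qed
    have "modulus_sq f h \<le> 4 * pi\<^sup>2 * r\<^sup>2 * (K * (4 powr (1 - \<alpha>)) ^ n) + 4 * (C * (4 powr - \<alpha>) ^ n)"
    proof (rule modulus_sq_le[OF f])
      fix F assume F: "finite F" "F \<subseteq> D"
      have small: "(cmod (lattice_char \<kappa> h - 1))\<^sup>2 \<le> 4 * pi\<^sup>2 * r\<^sup>2 * (norm \<kappa>)\<^sup>2" for \<kappa>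
      proof -
        have "cmod (lattice_char \<kappa> h - 1) \<le> 2 * \<bar>pi * (\<kappa> \<bullet> h)\<bar>"
          unfolding norm_lattice_char_minus_1 by (intro mult_left_mono abs_sin_x_le_abs_x) auto
        also have "\<dots> = 2 * pi * \<bar>\<kappa> \<bullet> h\<bar>" by (simp add: abs_mult)
        also have "\<dots> \<le> 2 * pi * (norm \<kappa> * r)"
          unfolding r_def by (intro mult_left_mono Cauchy_Schwarz_ineq2) auto
        finally have "(cmod (lattice_char \<kappa> h - 1))\<^sup>2 \<le> (2 * pi * (norm \<kappa> * r))\<^sup>2" by (intro power_mono) auto
        then show ?thesis by (simp add: power_mult_distrib mult_ac)
      qed
      have large: "(cmod (lattice_char \<kappa> h - 1))\<^sup>2 \<le> 4" for \<kappa>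
      proof -
        have "cmod (lattice_char \<kappa> h - 1) \<le> 2" unfolding norm_lattice_char_minus_1 by simp
        then show ?thesis using power_mono[of _ 2 2] by fastforce
      qed
      \<comment> \<open>The cut is at 2^n, comparable to 1/r: below it the linear bound on the phase
        is the efficient one, above it the trivial bound 4 is.\<close>
      have "F = {\<kappa> \<in> F. norm \<kappa> \<le> 2 ^ n} \<union> {\<kappa> \<in> F. 2 ^ n < norm \<kappa>}" by auto
      then have "(\<Sum>\<kappa>\<in>F. (cmod (lattice_char \<kappa> h - 1))\<^sup>2 * ?a \<kappa>)
          = (\<Sum>\<kappa>\<in>{\<kappa> \<in> F. norm \<kappa> \<le> 2 ^ n}. (cmod (lattice_char \<kappa> h - 1))\<^sup>2 * ?a \<kappa>)
          + (\<Sum>\<kappa>\<in>{\<kappa> \<in> F. 2 ^ n < norm \<kappa>}. (cmod (lattice_char \<kappa> h - 1))\<^sup>2 * ?a \<kappa>)"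
        using F(1) by (subst sum.union_disjoint[symmetric]) auto
      also have "\<dots> \<le> (\<Sum>\<kappa>\<in>{\<kappa> \<in> F. norm \<kappa> \<le> 2 ^ n}. 4 * pi\<^sup>2 * r\<^sup>2 * (norm \<kappa>)\<^sup>2 * ?a \<kappa>)
          + (\<Sum>\<kappa>\<in>{\<kappa> \<in> F. 2 ^ n < norm \<kappa>}. 4 * ?a \<kappa>)"
        using small large by (intro add_mono sum_mono mult_right_mono) auto
      also have "\<dots> = 4 * pi\<^sup>2 * r\<^sup>2 * (\<Sum>\<kappa>\<in>{\<kappa> \<in> F. norm \<kappa> \<le> 2 ^ n}. (norm \<kappa>)\<^sup>2 * ?a \<kappa>)
          + 4 * (\<Sum>\<kappa>\<in>{\<kappa> \<in> F. 2 ^ n < norm \<kappa>}. ?a \<kappa>)"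
        by (simp add: sum_distrib_left mult_ac)
      also have "\<dots> \<le> 4 * pi\<^sup>2 * r\<^sup>2 * (K * (4 powr (1 - \<alpha>)) ^ n) + 4 * (C * (4 powr - \<alpha>) ^ n)"
        unfolding K_def using F C \<alpha> tails sumS
        by (intro add_mono mult_left_mono weighted_sum_le_of_dyadic_tails tails) auto
      finally show "(\<Sum>\<kappa>\<in>F. (cmod (lattice_char \<kappa> h - 1))\<^sup>2 * ?a \<kappa>)
          \<le> 4 * pi\<^sup>2 * r\<^sup>2 * (K * (4 powr (1 - \<alpha>)) ^ n) + 4 * (C * (4 powr - \<alpha>) ^ n)" .
    qed
    also have "\<dots> \<le> 4 * pi\<^sup>2 * r\<^sup>2 * (K * r powr (2 * \<alpha> - 2)) + 4 * (C * (4 powr \<alpha> * r powr (2 * \<alpha>)))"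
      using q1 q2 K C by (intro add_mono mult_left_mono) auto
    also have "\<dots> = B * r powr (2 * \<alpha>)"
    proof -
      have "r\<^sup>2 * r powr (2 * \<alpha> - 2) = r powr (2 * \<alpha>)"
        using r by (simp add: powr_diff powr_numeral)
      then have "4 * pi\<^sup>2 * r\<^sup>2 * (K * r powr (2 * \<alpha> - 2)) = 4 * pi\<^sup>2 * K * r powr (2 * \<alpha>)"
        by (metis mult.assoc mult.commute)
      then show ?thesis by (simp add: B_def algebra_simps)
    qed
    finally show ?thesis by (simp add: r_def)
  qed
  have "norm (sqrt (modulus_sq f h)) \<le> sqrt B * norm (norm h powr \<alpha>)" if h: "h \<noteq> 0" "norm h < 1" for h
  proof -
    have "sqrt (modulus_sq f h) \<le> sqrt (B * norm h powr (2 * \<alpha>))" using main[OF h] by simp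
    also have "norm h powr (2 * \<alpha>) = (norm h powr \<alpha>)\<^sup>2" using h by (simp add: powr_power mult.commute)
    finally show ?thesis using modulus_sq_nonneg[of f h] by (simp add: real_sqrt_mult)
  qed
  then have "\<forall>\<^sub>F h in at 0. norm (sqrt (modulus_sq f h)) \<le> sqrt B * norm (norm h powr \<alpha>)"
    unfolding eventually_at by (intro exI[of _ 1]) (auto simp: dist_norm)
  then show ?thesis by (rule bigoI)
qed

end

theorem theoremB:
  fixes A :: "real^'n^'n" and \<Omega> :: "(real^'n) set"
    and f :: "real^'n \<Rightarrow> complex" and \<alpha> :: real
  assumes "invertible A"
    and "fundamental_domain (lattice_of A) \<Omega>"
    and "0 < \<alpha>" and "\<alpha> < 1"
    and "f \<in> Lp_space (normalised_measure \<Omega>) 2"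
  shows "f \<in> Lip (lattice_of A) \<Omega> \<alpha> 2 \<longleftrightarrow>
    (\<lambda>N::nat. \<Sum>\<^sub>\<infinity>\<kappa>\<in>{\<kappa> \<in> dual_lattice A. norm \<kappa> > real N}. (cmod (fourier_coeff \<Omega> f \<kappa>))\<^sup>2)
      \<in> O(\<lambda>N. real N powr (- 2 * \<alpha>))"
proof -
  interpret lattice_domain A \<Omega> by unfold_locales fact+
  have f: "L2 f" using assms(5) by (simp add: L2_iff_Lp_space)
  then have "coeff f \<kappa> = fourier_coeff \<Omega> f \<kappa>" for \<kappa> by (intro coeff_eq_fourier_coeff) (simp add: L2_def)
  then show ?thesis
    using Lip_iff[OF f, of \<alpha>] tail_bigo_of_modulus[OF f assms(3)] modulus_bigo_of_tail[OF f assms(3,4)]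
    unfolding tail_def by auto
qed

end
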